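(* Let $\mathfrak M$ be the variety of all metabelian algebras over a field $F$ of characteristic $0$, i.e. the variety defined by the single identity $(xy)(zt)=0$. Let $r,s,r',s'$ be nonnegative integers. The inclusion $\mathfrak M_{r',s'}\subseteq\mathfrak M_{r,s}$ holds only if $r'\leqslant r$ and $s'\leqslant s$. The equality $\mathfrak M_{r',s'}=\mathfrak M_{r,s}$ takes place only if $r'=r$ and $s'=s$.
   Context: All algebras are over a field $F$ of characteristic $0$ and are not assumed associative or unital. A superalgebra is a $\mathbb Z_2$-graded algebra $\mathcal A=\mathcal A_0+\mathcal A_1$, $\mathcal A_i\mathcal A_j\subseteq\mathcal A_{i+j \bmod 2}$. $\mathrm G=\mathrm G_0+\mathrm G_1$ is the Grassmann algebra on countably many anticommuting generators $e_1,e_2,\dots$ ($\mathrm G_0$, $\mathrm G_1$ spanned by words of even, resp. odd, length). The Grassmann envelope of $\mathcal A$ is $\mathrm G(\mathcal A)=\mathrm G_0\otimes\mathcal A_0+\mathrm G_1\otimes\mathcal A_1\subseteq \mathrm G\otimes\mathcal A$. For a multilinear polynomial $f$, its superization $\tilde f$ is obtained by the Koszul sign rule (a sign $(-1)^{ij}$ whenever a variable of parity $i$ passes through one of parity $j$); $\mathcal A$ satisfies the superidentity $\tilde f=0$ if and only if $\mathrm G(\mathcal A)$ satisfies $f=0$. For a variety $\mathcal V$, a $\mathcal V$-superalgebra is a superalgebra $\mathcal A$ with $\mathrm G(\mathcal A)\in\mathcal V$. The supervariety generated by a superalgebra $\mathcal B$ is the class of all superalgebras satisfying every superidentity $\tilde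 f=0$ ($f$ multilinear) satisfied by $\mathcal B$. For nonnegative integers $(r,s)\ne(0,0)$, $\mathcal V_{r,s}$ is the supervariety generated by the free $\mathcal V$-superalgebra on $r$ even and $s$ odd generators; $\mathcal V_{0,0}=\{\{0\}\}$. *)

theory Defs
  imports
    "HOL-Algebra.QuotRing"
    "HOL-Algebra.Module"
    "HOL-Algebra.Algebraic_Closure_Type"
    "HOL-Library.Poly_Mapping"
    "HOL-Library.Z2"
begin

section \<open>Algebras and superalgebras\<close>

text \<open>
  The ground field is the type \<open>'k\<close>, viewed as a \<open>HOL-Algebra\<close> ring where a locale asks for one.
  Algebras are \<^type>\<open>module\<close> records, so that \<^const>\<open>carrier\<close>, \<^const>\<open>add\<close>, \<^const>\<open>monoid.mult\<close>
  and \<^const>\<open>finsum\<close> are those of the library; neither associativity nor a unit is required,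
  and the record field \<^const>\<open>monoid.one\<close> has no meaning and is never used.
\<close>

abbreviation scalars :: "'k::field ring"
  where "scalars \<equiv> ring_of_type_algebra"

locale nonassoc_algebra = module scalars A
  for A :: "('k::field, 'a, 'm) module_scheme" (structure) +
  assumes mult_closed:
      "\<lbrakk>x \<in> carrier A; y \<in> carrier A\<rbrakk> \<Longrightarrow> x \<otimes> y \<in> carrier A"
    and mult_add_left:
      "\<lbrakk>x \<in> carrier A; y \<in> carrier A; z \<in> carrier A\<rbrakk> \<Longrightarrow> (x \<oplus> y) \<otimes> z = x \<otimes> z \<oplus> y \<otimes> z"
    and mult_add_right:
      "\<lbrakk>x \<in> carrier A; y \<in> carrier A; z \<in> carrier A\<rbrakk> \<Longrightarrow> z \<otimes> (x \<oplus> y) = z \<otimes> x \<oplus> z \<otimes> y"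
    and mult_smult_left:
      "\<lbrakk>x \<in> carrier A; y \<in> carrier A\<rbrakk> \<Longrightarrow> (c \<odot> x) \<otimes> y = c \<odot> (x \<otimes> y)"
    and mult_smult_right:
      "\<lbrakk>x \<in> carrier A; y \<in> carrier A\<rbrakk> \<Longrightarrow> x \<otimes> (c \<odot> y) = c \<odot> (x \<otimes> y)"

text \<open>The two homogeneous components are indexed by \<^typ>\<open>bit\<close>, the field with two elements.\<close>

record ('k, 'a) superalgebra = "('k, 'a) module" +
  component :: "bit \<Rightarrow> 'a set"

locale superalgebra = nonassoc_algebra A
  for A :: "('k::field, 'a, 'm) superalgebra_scheme" (structure) +
  assumes component_submodule: "submodule (component A i) scalars A"
    and component_sum: "component A 0 <+> component A 1 = carrier A"
    and component_disjoint: "component A 0 \<inter> component A 1 = {\<zero>}"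
    and component_mult:
      "\<lbrakk>x \<in> component A i; y \<in> component A j\<rbrakk> \<Longrightarrow> x \<otimes> y \<in> component A (i + j)"


section \<open>Nonassociative polynomials, identities and varieties\<close>

datatype 'x word = Gen 'x | Prod "'x word" "'x word"

primrec letters :: "'x word \<Rightarrow> 'x list"
  where
    "letters (Gen x) = [x]"
  | "letters (Prod u v) = letters u @ letters v"

text \<open>A nonassociative polynomial is a finitely supported function on nonassociative words.\<close>

type_synonym ('k, 'x) nonassoc_poly = "'x word \<Rightarrow>\<^sub>0 'k"

definition multilinear :: "('k::zero, 'x) nonassoc_poly \<Rightarrow> bool"
  where "multilinear f \<longleftrightarrow>
    (\<exists>V. \<forall>w \<in> Poly_Mapping.keys f. distinct (letters w) \<and> set (letters w) = V)"

primrec eval_word :: "('k, 'a, 'm) module_scheme \<Rightarrow> ('x \<Rightarrow> 'a) \<Rightarrow> 'x word \<Rightarrow> 'a"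
  where
    "eval_word A a (Gen x) = a x"
  | "eval_word A a (Prod u v) = eval_word A a u \<otimes>\<^bsub>A\<^esub> eval_word A a v"

definition eval_poly ::
    "('k::zero, 'a, 'm) module_scheme \<Rightarrow> ('x \<Rightarrow> 'a) \<Rightarrow> ('k, 'x) nonassoc_poly \<Rightarrow> 'a"
  where "eval_poly A a f =
    (\<Oplus>\<^bsub>A\<^esub> w \<in> Poly_Mapping.keys f. Poly_Mapping.lookup f w \<odot>\<^bsub>A\<^esub> eval_word A a w)"

definition satisfies ::
    "('k::zero, 'a, 'm) module_scheme \<Rightarrow> ('k, nat) nonassoc_poly \<Rightarrow> bool"
  where "satisfies A f \<longleftrightarrow> (\<forall>a. range a \<subseteq> carrier A \<longrightarrow> eval_poly A a f = \<zero>\<^bsub>A\<^esub>)"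

definition variety :: "('k::field, nat) nonassoc_poly set \<Rightarrow> ('k, 'a) module set"
  where "variety T = {A. nonassoc_algebra A \<and> (\<forall>f \<in> T. satisfies A f)}"

text \<open>The identity \<open>(xy)(zt) = 0\<close>.\<close>

definition metabelian_poly :: "('k::zero_neq_one, nat) nonassoc_poly"
  where "metabelian_poly =
    Poly_Mapping.single (Prod (Prod (Gen 0) (Gen 1)) (Prod (Gen 2) (Gen 3))) 1"


section \<open>The Grassmann envelope\<close>

text \<open>
  The Grassmann algebra has the basis \<open>e\<^sub>S = e\<^bsub>i1\<^esub> \<dots> e\<^bsub>ik\<^esub>\<close>, where \<open>S = {i1 < \<dots> < ik}\<close> ranges over the finite
  sets of natural numbers. The product \<open>e\<^sub>S e\<^sub>T\<close> is \<open>grassmann_sign S T\<close> times the basis element of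
  \<open>S \<union> T\<close> if \<open>S\<close> and \<open>T\<close> are disjoint, and \<open>0\<close> otherwise. The empty word is the unit.
\<close>

definition grassmann_sign :: "nat set \<Rightarrow> nat set \<Rightarrow> 'k::field"
  where "grassmann_sign S T = (- 1) ^ card {(i, j). i \<in> S \<and> j \<in> T \<and> j < i}"

text \<open>
  The tensor \<open>\<Sum>\<^sub>S e\<^sub>S \<otimes> h S\<close> is represented by the finitely supported coefficient function \<open>h\<close>;
  it lies in the envelope iff each \<open>h S\<close> is homogeneous of the parity of the cardinality of \<open>S\<close>.
\<close>

definition grassmann_envelope ::
    "('k::field, 'a, 'm) superalgebra_scheme \<Rightarrow> ('k, nat set \<Rightarrow> 'a) module"
  where "grassmann_envelope A =
    \<lparr>carrier = {h. finite {S. h S \<noteq> \<zero>\<^bsub>A\<^esub>} \<and>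
        (\<forall>S. if finite S then h S \<in> component A (of_nat (card S)) else h S = \<zero>\<^bsub>A\<^esub>)},
     monoid.mult = (\<lambda>h g U. if finite U
        then \<Oplus>\<^bsub>A\<^esub> S \<in> Pow U. grassmann_sign S (U - S) \<odot>\<^bsub>A\<^esub> (h S \<otimes>\<^bsub>A\<^esub> g (U - S))
        else \<zero>\<^bsub>A\<^esub>),
     monoid.one = undefined,
     ring.zero = (\<lambda>_. \<zero>\<^bsub>A\<^esub>),
     ring.add = (\<lambda>h g S. h S \<oplus>\<^bsub>A\<^esub> g S),
     module.smult = (\<lambda>c h S. c \<odot>\<^bsub>A\<^esub> h S)\<rparr>"

definition variety_superalgebra ::
    "('k::field, nat) nonassoc_poly set \<Rightarrow> ('k, 'a) superalgebra \<Rightarrow> bool"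
  where "variety_superalgebra T A \<longleftrightarrow> superalgebra A \<and> grassmann_envelope A \<in> variety T"


section \<open>Superidentities and supervarieties\<close>

text \<open>
  The Koszul sign of reordering the variables from their natural order into the order in which
  they occur in a word: each inversion between two odd variables contributes \<open>- 1\<close>.
\<close>

definition koszul_sign :: "(nat \<Rightarrow> bit) \<Rightarrow> nat list \<Rightarrow> 'k::field"
  where "koszul_sign p xs =
    (- 1) ^ card {(i, j). i < j \<and> j < length xs \<and> xs ! j < xs ! i \<and>
      p (xs ! i) = 1 \<and> p (xs ! j) = 1}"

text \<open>
  Value of the superization of a multilinear \<open>f\<close> when the variables \<open>v\<close> have parities \<open>p v\<close>
  and homogeneous values \<open>a v\<close>.
\<close>

definition super_eval :: "('k::field, 'a, 'm) superalgebra_scheme \<Rightarrow> (nat \<Rightarrow> bit) \<Rightarrow>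
    (nat \<Rightarrow> 'a) \<Rightarrow> ('k, nat) nonassoc_poly \<Rightarrow> 'a"
  where "super_eval A p a f =
    (\<Oplus>\<^bsub>A\<^esub> w \<in> Poly_Mapping.keys f.
       (koszul_sign p (letters w) * Poly_Mapping.lookup f w) \<odot>\<^bsub>A\<^esub> eval_word A a w)"

definition super_satisfies ::
    "('k::field, 'a, 'm) superalgebra_scheme \<Rightarrow> ('k, nat) nonassoc_poly \<Rightarrow> bool"
  where "super_satisfies A f \<longleftrightarrow>
    (\<forall>p a. (\<forall>v. a v \<in> component A (p v)) \<longrightarrow> super_eval A p a f = \<zero>\<^bsub>A\<^esub>)"

text \<open>
  The members of the supervariety generated by \<open>B\<close> whose carrier is a subset of the type \<open>'u\<close>.
\<close>

definition generated_supervariety ::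
    "('k::field, 'b) superalgebra \<Rightarrow> ('k, 'u) superalgebra set"
  where "generated_supervariety B =
    {A. superalgebra A \<and>
        (\<forall>f. multilinear f \<and> super_satisfies B f \<longrightarrow> super_satisfies A f)}"


section \<open>Free superalgebras of a variety\<close>

text \<open>Generators \<open>Inl i\<close> are even, generators \<open>Inr j\<close> are odd.\<close>

primrec parity :: "(nat + nat) word \<Rightarrow> bit"
  where
    "parity (Gen x) = (case x of Inl _ \<Rightarrow> 0 | Inr _ \<Rightarrow> 1)"
  | "parity (Prod u v) = parity u + parity v"

definition free_carrier :: "nat \<Rightarrow> nat \<Rightarrow> ('k::field, nat + nat) nonassoc_poly set"
  where "free_carrier r s =
    {p. \<forall>w \<in> Poly_Mapping.keys p. set (letters w) \<subseteq> Inl ` {..<r} \<union> Inr ` {..<s}}"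

definition free_superalgebra ::
    "nat \<Rightarrow> nat \<Rightarrow> ('k::field, ('k, nat + nat) nonassoc_poly) superalgebra"
  where "free_superalgebra r s =
    \<lparr>carrier = free_carrier r s,
     monoid.mult = (\<lambda>p q. \<Sum>u \<in> Poly_Mapping.keys p. \<Sum>v \<in> Poly_Mapping.keys q.
        Poly_Mapping.single (Prod u v) (Poly_Mapping.lookup p u * Poly_Mapping.lookup q v)),
     monoid.one = undefined,
     ring.zero = 0,
     ring.add = (+),
     module.smult = (\<lambda>c. Poly_Mapping.map ((*) c)),
     component = (\<lambda>i. {p \<in> free_carrier r s. \<forall>w \<in> Poly_Mapping.keys p. parity w = i})\<rparr>"

locale graded_ideal = superalgebra A + submodule I scalars A
  for I and A :: "('k::field, 'a, 'm) superalgebra_scheme" (structure) +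
  assumes ideal_left: "\<lbrakk>a \<in> carrier A; x \<in> I\<rbrakk> \<Longrightarrow> a \<otimes> x \<in> I"
    and ideal_right: "\<lbrakk>a \<in> carrier A; x \<in> I\<rbrakk> \<Longrightarrow> x \<otimes> a \<in> I"
    and ideal_graded: "(I \<inter> component A 0) <+> (I \<inter> component A 1) = I"

definition quotient_superalgebra ::
    "('k::field, 'a, 'm) superalgebra_scheme \<Rightarrow> 'a set \<Rightarrow> ('k, 'a set) superalgebra"
  where "quotient_superalgebra A I =
    \<lparr>carrier = a_rcosets\<^bsub>A\<^esub> I,
     monoid.mult = rcoset_mult A I,
     monoid.one = undefined,
     ring.zero = I,
     ring.add = set_add A,
     module.smult = (\<lambda>c C. \<Union>x \<in> C. I +>\<^bsub>A\<^esub> (c \<odot>\<^bsub>A\<^esub> x)),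
     component = (\<lambda>i. (\<lambda>x. I +>\<^bsub>A\<^esub> x) ` component A i)\<rparr>"

text \<open>
  The free superalgebra of the variety defined by \<open>T\<close> on \<open>r\<close> even and \<open>s\<close> odd generators is the
  largest quotient of the absolutely free one whose Grassmann envelope lies in the variety.
  The quotient by the intersection has this property too, since it embeds into the product
  of the quotients by the individual ideals.
\<close>

definition free_variety_superalgebra ::
    "('k::field, nat) nonassoc_poly set \<Rightarrow> nat \<Rightarrow> nat \<Rightarrow>
      ('k, ('k, nat + nat) nonassoc_poly set) superalgebra"
  where "free_variety_superalgebra T r s =
    quotient_superalgebra (free_superalgebra r s)
      (\<Inter> {I. graded_ideal I (free_superalgebra r s) \<and>
              variety_superalgebra T (quotient_superalgebra (free_superalgebra r s) I)})"

definition rank_supervariety ::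
    "('k::field, nat) nonassoc_poly set \<Rightarrow> nat \<Rightarrow> nat \<Rightarrow> ('k, 'u) superalgebra set"
  where "rank_supervariety T r s =
    (if r = 0 \<and> s = 0 then {A. superalgebra A \<and> carrier A = {\<zero>\<^bsub>A\<^esub>}}
     else generated_supervariety (free_variety_superalgebra T r s))"

text \<open>
  The supervarieties for the variety of all metabelian algebras, with \<open>'u\<close> as the universe
  from which the elements of the superalgebras are taken. Classes at \<open>'u\<close> are meaningful only if
  \<open>'u\<close> has room for the free superalgebras of finite rank, which is the case if the absolutely
  free algebra on countably many generators injects into \<open>'u\<close>.
\<close>

definition metabelian_supervariety :: "nat \<Rightarrow> nat \<Rightarrow> ('k::field_char_0, 'u) superalgebra set"
  where "metabelian_supervariety r s = rank_supervariety {metabelian_poly} r s"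

end

theory Submission
  imports Defs "HOL-Combinatorics.Permutations"
begin

text \<open>
  In a metabelian superalgebra an element acts on the square of the algebra, by left or right
  multiplication, only through its class modulo the square. In the free metabelian superalgebra on
  \<open>r\<close> even and \<open>s\<close> odd generators these operators satisfy no further relations. So the value of
  \<open>(\<dots>((x\<^sub>0 x\<^sub>1) x\<^sub>2) \<dots>) x\<^bsub>n+1\<^esub>\<close> depends on \<open>x\<^sub>2, \<dots>, x\<^bsub>n+1\<^esub>\<close> only through a tensor of degree \<open>n\<close> over the
  superspace \<open>V\<close> of dimension \<open>(r | s)\<close> spanned by the generators, and superidentities arise from the
  elements of the group algebra of the symmetric group that annihilate \<open>V\<^bsup>\<otimes>n\<^esup>\<close> under the action with
  Koszul signs. By the hook theorem of Berele and Regev those are the elements that belong to Young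
  diagrams containing a rectangle with \<open>r + 1\<close> rows and \<open>s + 1\<close> columns.

  For the separation of the ranks a larger rectangle suffices, and then counting replaces
  representation theory. Let the variables as well as the positions be the cells of a rectangle with
  \<open>P\<close> rows and \<open>Q\<close> columns, and let \<open>young_poly\<close> be symmetric in the variables of each row and
  skew-symmetric in the positions of each column. If two positions of one column receive the same
  even generator, the terms cancel in pairs; so at most \<open>r Q\<close> positions are occupied by even
  generators. Symmetry in a superspace is skew symmetry on odd values; so the terms also cancel
  if more than \<open>s\<close> variables of one row are odd, and at most \<open>s P\<close> positions are occupied by odd
  generators. Hence \<open>young_poly\<close> is a superidentity of rank \<open>(r, s)\<close> as soon as \<open>r Q + s P < P Q\<close>
  (\<open>young_sum_vanishes\<close>, \<open>young_poly_identity\<close>).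

  On the other hand \<open>P\<close> even generators, one for each row, do not annihilate it: only the identity
  permutation preserves both rows and columns, so the terms that survive add up instead of
  cancelling (\<open>young_sum_rows\<close>). In the same way \<open>Q\<close> odd generators, one for each column, do not
  annihilate it (\<open>young_sum_columns\<close>). If \<open>r < r'\<close>, take \<open>P = r + 1\<close> and \<open>Q = s P + 1\<close>; if \<open>s < s'\<close>, take
  \<open>Q = s + 1\<close> and \<open>P = r Q + 1\<close>. In both cases the inequality holds, and the polynomial is a
  superidentity of rank \<open>(r, s)\<close> but not of rank \<open>(r', s')\<close> (\<open>rank_le_of_supervariety_subset\<close>).

  To make this a computation with words, the ideal that defines the free metabelian superalgebra is
  identified with the span of the words that have a factor \<open>(u v) (w z)\<close>
  (\<open>free_metabelian_superalgebra_eq\<close>). An inclusion of supervarieties transports superidentities since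
  the free superalgebra has an isomorphic copy on the universe, which lies in its own supervariety
  (\<open>super_satisfies_of_supervariety_subset\<close>). Quotients and copies are both treated as images under a
  \<open>superalgebra_epimorphism\<close>.
\<close>

section \<open>Koszul signs\<close>

lemma koszul_sign_Cons:
  "koszul_sign p (x # xs) =
     (\<Prod>y\<leftarrow>xs. if y < x \<and> p x = 1 \<and> p y = 1 then - 1 else 1) * (koszul_sign p xs :: 'k::field)"
proof -
  let ?I = "\<lambda>xs. {(i, j). i < j \<and> j < length xs \<and> xs ! j < xs ! i \<and>
      p (xs ! i) = 1 \<and> p (xs ! j) = 1}"
  let ?H = "{j. j < length xs \<and> xs ! j < x \<and> p x = 1 \<and> p (xs ! j) = 1}"
  have fin: "finite (?I xs)"
    by (rule finite_subset[of _ "{..<length xs} \<times> {..<length xs}"]) auto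
  have "?I (x # xs) = (\<lambda>j. (0, Suc j)) ` ?H \<union> (\<lambda>(i, j). (Suc i, Suc j)) ` ?I xs"
  proof (rule Set.set_eqI)
    fix e :: "nat \<times> nat"
    obtain i j where e: "e = (i, j)" by (cases e)
    show "e \<in> ?I (x # xs) \<longleftrightarrow>
        e \<in> (\<lambda>j. (0, Suc j)) ` ?H \<union> (\<lambda>(i, j). (Suc i, Suc j)) ` ?I xs"
      unfolding e by (cases i; cases j) (auto simp: image_iff)
  qed
  moreover have "card \<dots> = card ?H + card (?I xs)"
    by (subst card_Un_disjoint) (use fin in \<open>auto simp: card_image inj_on_def\<close>)
  moreover have "(- 1 :: 'k) ^ card ?H = (\<Prod>y\<leftarrow>xs. if y < x \<and> p x = 1 \<and> p y = 1 then - 1 else 1)"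
  proof -
    have "card ?H = length (filter (\<lambda>y. y < x \<and> p x = 1 \<and> p y = 1) xs)"
      by (simp add: length_filter_conv_card)
    moreover have "(- 1 :: 'k) ^ length (filter Q xs) = (\<Prod>y\<leftarrow>xs. if Q y then - 1 else 1)" for Q
      by (induction xs) auto
    ultimately show ?thesis by metis
  qed
  ultimately show ?thesis
    by (simp add: koszul_sign_def power_add)
qed

lemma koszul_sign_append:
  "koszul_sign p (xs @ ys) = koszul_sign p xs * koszul_sign p ys *
     (\<Prod>x\<leftarrow>xs. \<Prod>y\<leftarrow>ys. if y < x \<and> p x = 1 \<and> p y = 1 then - 1 else (1 :: 'k::field))"
proof (induction xs)
  case Nil
  then show ?case by (simp add: koszul_sign_def)
next
  case (Cons x xs)
  show ?case unfolding append_Cons koszul_sign_Cons Cons.IH by simp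
qed

text \<open>
  Only pairs that involve \<open>x\<close> or \<open>y\<close> are affected. Reversing a pair of distinct odd letters changes its
  sign, but for a letter \<open>b\<close> between \<open>x\<close> and \<open>y\<close> two pairs are reversed; so only the pair of \<open>x\<close> and \<open>y\<close>
  itself can change the sign.
\<close>
lemma koszul_sign_swap:
  assumes dist: "distinct (as @ x # bs @ y # cs)" and par: "p x = p y"
  shows "koszul_sign p (as @ y # bs @ x # cs) =
     (if p x = 1 then - 1 else 1) * (koszul_sign p (as @ x # bs @ y # cs) :: 'k::field)"
proof -
  define c where "c = (\<lambda>x y. if y < x \<and> p x = 1 \<and> p y = 1 then - 1 else (1::'k))"
  have Cons: "koszul_sign p (x # xs) = (\<Prod>y\<leftarrow>xs. c x y) * koszul_sign p xs" for x xs
    unfolding c_def by (rule koszul_sign_Cons)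
  have app: "koszul_sign p (xs @ ys) = koszul_sign p xs * koszul_sign p ys *
      (\<Prod>x\<leftarrow>xs. \<Prod>y\<leftarrow>ys. c x y)" for xs ys
    unfolding c_def by (rule koszul_sign_append)
  have multf: "(\<Prod>b\<leftarrow>bs. f b * h b) = (\<Prod>b\<leftarrow>bs. f b) * (\<Prod>b\<leftarrow>bs. h b)" for bs :: "nat list" and f h :: "nat \<Rightarrow> 'k"
    by (induction bs) (simp_all add: mult_ac)
  have mid: "(\<Prod>b\<leftarrow>bs. c y b) * (\<Prod>b\<leftarrow>bs. c b x) = (\<Prod>b\<leftarrow>bs. c x b) * (\<Prod>b\<leftarrow>bs. c b y)"
    using dist
  proof (induction bs)
    case (Cons b bs)
    have "c y b * c b x = c x b * c b y"
      using Cons.prems par by (auto simp: c_def)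
    then show ?case using Cons by (simp add: algebra_simps)
  qed simp
  have ends: "c y x = (if p x = 1 then - 1 else 1) * c x y"
    using dist par by (auto simp: c_def)
  have core: "koszul_sign p (y # bs @ x # cs) =
      (if p x = 1 then - 1 else 1) * (koszul_sign p (x # bs @ y # cs) :: 'k)"
  proof -
    have *: "koszul_sign p (u # bs @ v # cs) =
        c u v * ((\<Prod>b\<leftarrow>bs. c u b) * (\<Prod>b\<leftarrow>bs. c b v)) *
        ((\<Prod>b\<leftarrow>cs. c u b) * (\<Prod>b\<leftarrow>cs. c v b) * koszul_sign p bs * koszul_sign p cs *
          (\<Prod>b\<leftarrow>bs. \<Prod>d\<leftarrow>cs. c b d))" for u v
      unfolding Cons app by (simp add: multf mult_ac)
    show ?thesis unfolding * mid ends by (simp add: algebra_simps)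
  qed
  have cross: "(\<Prod>d\<leftarrow>y # bs @ x # cs. c a d) = (\<Prod>d\<leftarrow>x # bs @ y # cs. c a d)" for a
    by (simp add: mult_ac)
  show ?thesis unfolding app[of as] core cross by (simp only: mult_ac)
qed

text \<open>
  The prefix \<open>pre\<close> is there for the variables of a word that are not permuted.
\<close>
lemma koszul_sign_transpose:
  assumes inj: "inj_on v {..<n}" and ij: "i < n" "j < n" "i \<noteq> j" and par: "p (v i) = p (v j)"
    and pre: "distinct pre" "set pre \<inter> v ` {..<n} = {}"
  shows "koszul_sign p (pre @ map (v \<circ> transpose i j) [0..<n]) =
     (if p (v i) = 1 then - 1 else 1) * (koszul_sign p (pre @ map v [0..<n]) :: 'k::field)"
proof -
  have *: "koszul_sign p (pre @ map (v \<circ> transpose i j) [0..<n]) =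
     (if p (v i) = 1 then - 1 else 1) * (koszul_sign p (pre @ map v [0..<n]) :: 'k::field)"
    if ij: "i < j" "j < n" and par: "p (v i) = p (v j)" for i j
  proof -
    have up: "[0..<n] = [0..<i] @ i # [Suc i..<j] @ j # [Suc j..<n]"
    proof -
      have split: "[a..<c] = [a..<b] @ b # [Suc b..<c]" if "a \<le> b" "b < c" for a b c
      proof -
        have "c = b + (c - b)" using that by simp
        then show ?thesis
          using upt_add_eq_append[OF that(1), of "c - b"] upt_conv_Cons[OF that(2)] by simp
      qed
      show ?thesis
        using split[of 0 i n] split[of "Suc i" j n] ij by simp
    qed
    have "v \<circ> transpose i j = v(i := v j, j := v i)"
      by (auto simp: transpose_def fun_eq_iff)
    then have "map (v \<circ> transpose i j) [0..<n] =
        map v [0..<i] @ v j # map v [Suc i..<j] @ v i # map v [Suc j..<n]"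
      unfolding up using ij by (simp)
    moreover have "map v [0..<n] =
        map v [0..<i] @ v i # map v [Suc i..<j] @ v j # map v [Suc j..<n]"
      unfolding up by simp
    moreover have "distinct (pre @ map v [0..<n])"
      using inj pre by (auto simp: distinct_map atLeast0LessThan)
    ultimately show ?thesis
      using koszul_sign_swap[of "pre @ map v [0..<i]" "v i" "map v [Suc i..<j]" "v j"
          "map v [Suc j..<n]" p] par by simp
  qed
  show ?thesis
  proof (cases "i < j")
    case True
    then show ?thesis using * ij par by simp
  next
    case False
    then have "j < i" using ij by simp
    then show ?thesis using *[of j i] ij par by (simp add: transpose_commute)
  qed
qed

text \<open>
  Each transposition of positions changes both signs, so the claim follows along a factorization of \<open>v\<close>
  into transpositions.
\<close>
lemma koszul_sign_all_odd:
  assumes v: "v permutes {..<n}" and odd: "\<And>x. p x = 1"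
    and pre: "distinct pre" "set pre \<inter> f ` {..<n} = {}" and inj: "inj f"
  shows "koszul_sign p (pre @ map (f \<circ> v) [0..<n]) =
     of_int (sign v) * (koszul_sign p (pre @ map f [0..<n]) :: 'k::field)"
proof -
  have "finite {..<n}" by simp
  from this v show ?thesis
  proof (induction rule: permutes_rev_induct)
    case id
    then show ?case by simp
  next
    case (swap i j v)
    have "inj v" using swap by (simp add: permutes_inj)
    have im: "v ` {..<n} = {..<n}" using swap(4) by (rule permutes_image)
    have "(f \<circ> v) ` {..<n} = f ` {..<n}" by (simp only: image_comp[symmetric] im)
    then have "koszul_sign p (pre @ map (f \<circ> v \<circ> transpose i j) [0..<n]) =
       - (koszul_sign p (pre @ map (f \<circ> v) [0..<n]) :: 'k)"
      using koszul_sign_transpose[of "f \<circ> v" n i j p pre, where 'k = 'k] swap(1-3) pre odd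
        inj_on_subset[OF inj_compose[OF inj \<open>inj v\<close>] subset_UNIV]
      by simp
    moreover have "sign (v \<circ> transpose i j) = - sign v"
      using swap by (subst sign_compose)
        (auto simp: sign_swap_id permutation_swap_id intro: permutes_imp_permutation[of "{..<n}"])
    ultimately show ?case by (simp only: o_assoc swap.IH of_int_minus mult_minus_left)
  qed
qed

section \<open>Sums over row and column permutations\<close>
lemma sum_eq_zero_by_involution:
  fixes F :: "'a \<Rightarrow> 'k::field_char_0"
  assumes "\<And>x. x \<in> S \<Longrightarrow> h x \<in> S" "\<And>x. x \<in> S \<Longrightarrow> h (h x) = x" "\<And>x. x \<in> S \<Longrightarrow> F (h x) = - F x"
  shows "(\<Sum>x\<in>S. F x) = 0"
proof -
  have "(\<Sum>x\<in>S. F x) = (\<Sum>x\<in>S. F (h x))"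
    by (rule sum.reindex_bij_witness[of _ h h]) (use assms in auto)
  also have "\<dots> = - (\<Sum>x\<in>S. F x)"
    using assms(3) by (simp add: sum_negf)
  finally show ?thesis by simp
qed

lemma card_le_by_fibres:
  assumes "finite S" "\<And>x. x \<in> S \<Longrightarrow> c x < (m::nat)" "\<And>y. y < m \<Longrightarrow> card {x \<in> S. c x = y} \<le> k"
  shows "card S \<le> m * k"
proof -
  have "S = (\<Union>y\<in>{..<m}. {x \<in> S. c x = y})"
    using assms(2) by auto
  then have "card S \<le> (\<Sum>y\<in>{..<m}. card {x \<in> S. c x = y})"
    by (metis card_UN_le finite_lessThan)
  also have "\<dots> \<le> m * k"
    using sum_bounded_above[of "{..<m}" "\<lambda>y. card {x \<in> S. c x = y}" k] assms(3) by simp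
  finally show ?thesis .
qed

definition fibre_permutations :: "nat \<Rightarrow> (nat \<Rightarrow> nat) \<Rightarrow> (nat \<Rightarrow> nat) set"
  where "fibre_permutations n c = {v. v permutes {..<n} \<and> (\<forall>i. c (v i) = c i)}"

lemma finite_fibre_permutations [simp]: "finite (fibre_permutations n c)"
  unfolding fibre_permutations_def by (rule finite_subset[OF _ finite_permutations]) auto

lemma fibre_permutations_compose:
  "v \<in> fibre_permutations n c \<Longrightarrow> w \<in> fibre_permutations n c \<Longrightarrow> v \<circ> w \<in> fibre_permutations n c"
  by (auto simp: fibre_permutations_def intro: permutes_compose)

lemma transpose_in_fibre_permutations:
  "i < n \<Longrightarrow> j < n \<Longrightarrow> c i = c j \<Longrightarrow> transpose i j \<in> fibre_permutations n c"
  by (auto simp: fibre_permutations_def transpose_def intro: permutes_swap_id)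

lemma id_in_fibre_permutations [simp]: "id \<in> fibre_permutations n c"
  by (simp add: fibre_permutations_def permutes_id)

text \<open>
  The variables \<open>0\<close> and \<open>1\<close> start the word, and cell \<open>k\<close> is the variable \<open>k + 2\<close>. For fixed generators \<open>g i\<close>,
  this is the contribution of the word with the cell \<open>v i\<close> in position \<open>i\<close> to the coefficient of
  \<open>g 0 \<otimes> \<dots> \<otimes> g (n - 1)\<close>, if \<open>m k x\<close> is the coefficient of \<open>x\<close> in the value of cell \<open>k\<close>.
\<close>
definition young_term ::
    "(nat \<Rightarrow> bit) \<Rightarrow> nat \<Rightarrow> (nat \<Rightarrow> 'g \<Rightarrow> 'k) \<Rightarrow> (nat \<Rightarrow> 'g) \<Rightarrow> (nat \<Rightarrow> nat) \<Rightarrow> 'k::field"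
  where "young_term p n m g v =
    koszul_sign p ([0, 1] @ map (\<lambda>i. v i + 2) [0..<n]) * (\<Prod>i<n. m (v i) (g i))"

text \<open>
  If the product of coefficients is not zero, the two variables that change places have the parity of the common
  generator, so the Koszul sign changes exactly for an odd generator.
\<close>
lemma young_term_swap:
  fixes m :: "nat \<Rightarrow> 'g \<Rightarrow> 'k::field"
  assumes v: "v permutes {..<n}" and ij: "i < n" "j < n" "i \<noteq> j" and g: "g i = g j"
    and m: "\<And>k x. m k x \<noteq> 0 \<Longrightarrow> p (k + 2) = par x"
  shows "young_term p n m g (v \<circ> transpose i j) =
    (if par (g i) = 1 then - 1 else 1) * young_term p n m g v"
proof (cases "(\<Prod>i<n. m (v i) (g i)) = 0")
  let ?t = "transpose i j"
  have gt: "g (?t k) = g k" for k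
    using g by (auto simp: transpose_def)
  have prod: "(\<Prod>k<n. m ((v \<circ> ?t) k) (g k)) = (\<Prod>k<n. m (v k) (g k))"
    by (rule prod.reindex_bij_witness[of _ ?t ?t]) (use ij gt in \<open>auto simp: transpose_def\<close>)
  {
    case True
    then show ?thesis by (simp add: young_term_def prod[unfolded o_def])
  next
    case False
    then have "m (v i) (g i) \<noteq> 0" "m (v j) (g j) \<noteq> 0"
      using ij by (auto simp: prod_zero_iff)
    then have "p (v i + 2) = par (g i)" "p (v j + 2) = par (g i)"
      using m g by metis+
    moreover have "inj_on (\<lambda>i. v i + 2) {..<n}"
      using permutes_inj[OF v] by (auto simp: inj_on_def)
    ultimately show ?thesis
      using koszul_sign_transpose[of "\<lambda>i. v i + 2" n i j p "[0, 1]", where 'k = 'k] ij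
      unfolding young_term_def prod by (simp add: o_def image_iff)
  }
qed

text \<open>
  The pigeonhole argument. If a column contains an even generator twice, the column transposition of
  these two positions pairs off the terms. Otherwise there are at most \<open>r Q\<close> even positions, hence more than
  \<open>s P\<close> odd ones. A nonzero term needs as many odd variables as odd positions, so some row has more than \<open>s\<close>
  odd variables, two of which meet the same generator; exchanging them pairs off the terms.
\<close>
lemma young_sum_vanishes:
  fixes m :: "nat \<Rightarrow> nat + nat \<Rightarrow> 'k::field_char_0"
  assumes row: "\<And>i. i < n \<Longrightarrow> row i < P" and col: "\<And>i. i < n \<Longrightarrow> col i < Q"
    and size: "r * Q + s * P < n"
    and m: "\<And>k x. m k x \<noteq> 0 \<Longrightarrow> p (k + 2) = par x"
    and par: "\<And>i. par (Inl i) = 0" "\<And>j. par (Inr j) = 1"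
    and g: "g ` {..<n} \<subseteq> Inl ` {..<r} \<union> Inr ` {..<s}"
  shows "(\<Sum>\<sigma>\<in>fibre_permutations n col. \<Sum>\<tau>\<in>fibre_permutations n row.
    of_int (sign \<sigma>) * young_term p n m g (\<tau> \<circ> \<sigma>)) = 0"
proof -
  let ?C = "fibre_permutations n col" and ?R = "fibre_permutations n row"
  have perm: "v permutes {..<n}" if "v \<in> ?C \<union> ?R" for v
    using that by (auto simp: fibre_permutations_def)
  have comp: "\<tau> \<circ> \<sigma> permutes {..<n}" if "\<sigma> \<in> ?C" "\<tau> \<in> ?R" for \<sigma> \<tau>
    using that perm by (auto intro: permutes_compose)
  show ?thesis
  proof (cases "\<exists>i<n. \<exists>j<n. i \<noteq> j \<and> col i = col j \<and> g i = g j \<and> par (g i) = 0")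
    case True
    then obtain i j where ij: "i < n" "j < n" "i \<noteq> j" "col i = col j" "g i = g j" "par (g i) = 0"
      by blast
    let ?t = "transpose i j"
    have t: "?t \<in> ?C" using ij by (intro transpose_in_fibre_permutations)
    have "(\<Sum>\<sigma>\<in>?C. of_int (sign \<sigma>) * young_term p n m g (\<tau> \<circ> \<sigma>)) = 0" if \<tau>: "\<tau> \<in> ?R" for \<tau>
    proof (rule sum_eq_zero_by_involution[where h = "\<lambda>\<sigma>. \<sigma> \<circ> ?t"])
      fix \<sigma> assume \<sigma>: "\<sigma> \<in> ?C"
      show "\<sigma> \<circ> ?t \<in> ?C" using \<sigma> t by (rule fibre_permutations_compose)
      show "\<sigma> \<circ> ?t \<circ> ?t = \<sigma>" by (simp add: comp_assoc)
      have "sign (\<sigma> \<circ> ?t) = - sign \<sigma>"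
        using \<sigma> ij perm by (subst sign_compose)
          (auto simp: sign_swap_id permutation_swap_id intro: permutes_imp_permutation[of "{..<n}"])
      moreover have "young_term p n m g (\<tau> \<circ> \<sigma> \<circ> ?t) = young_term p n m g (\<tau> \<circ> \<sigma>)"
        using young_term_swap[of "\<tau> \<circ> \<sigma>" n i j g m p par] comp[OF \<sigma> \<tau>] ij m by simp
      ultimately show "of_int (sign (\<sigma> \<circ> ?t)) * young_term p n m g (\<tau> \<circ> (\<sigma> \<circ> ?t)) =
          - (of_int (sign \<sigma>) * young_term p n m g (\<tau> \<circ> \<sigma>))"
        by (simp add: o_assoc)
    qed
    then show ?thesis by (subst sum.swap) (simp add: sum.neutral)
  next
    case False
    let ?E = "{i \<in> {..<n}. par (g i) = 0}" and ?O = "{i \<in> {..<n}. par (g i) = 1}"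
    let ?V = "{k \<in> {..<n}. p (k + 2) = 1}"
    have "card ?E \<le> Q * r"
    proof (rule card_le_by_fibres)
      fix y assume "y < Q"
      have "card {i \<in> ?E. col i = y} \<le> card (Inl ` {..<r} :: (nat + nat) set)"
      proof (rule card_inj_on_le)
        show "inj_on g {i \<in> ?E. col i = y}" using False by (fastforce simp: inj_on_def)
        show "g ` {i \<in> ?E. col i = y} \<subseteq> Inl ` {..<r}" using g par by fastforce
      qed simp
      then show "card {i \<in> ?E. col i = y} \<le> r" by (simp add: card_image)
    qed (use col in auto)
    moreover have "card ?E + card ?O = n"
    proof -
      have "?E \<union> ?O = {..<n}" by (auto intro: bit_not_one_iff[THEN iffD1])
      moreover have "?E \<inter> ?O = {}" by auto
      ultimately show ?thesis
        by (metis (no_types, lifting) card_Un_disjoint card_lessThan finite_Un finite_lessThan)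
    qed
    ultimately have O: "P * s < card ?O" using size by (simp add: algebra_simps)
    \<comment> \<open>Here \<open>\<sigma>\<close> is fixed, so its sign is a common factor, and the cancellation takes place among the row permutations.\<close>
    have zero: "(\<Sum>\<tau>\<in>?R. young_term p n m g (\<tau> \<circ> \<sigma>)) = 0" if \<sigma>: "\<sigma> \<in> ?C" for \<sigma>
    proof (cases "card ?V \<le> P * s")
      case True
      have "young_term p n m g (\<tau> \<circ> \<sigma>) = 0" if \<tau>: "\<tau> \<in> ?R" for \<tau>
      proof (rule ccontr)
        assume "young_term p n m g (\<tau> \<circ> \<sigma>) \<noteq> 0"
        then have "m ((\<tau> \<circ> \<sigma>) i) (g i) \<noteq> 0" if "i < n" for i
          using that by (auto simp: young_term_def prod_zero_iff)
        then have "(\<tau> \<circ> \<sigma>) ` ?O \<subseteq> ?V"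
          using m permutes_in_image[OF comp[OF \<sigma> \<tau>]] by fastforce
        then have "card ?O \<le> card ?V"
          using permutes_inj[OF comp[OF \<sigma> \<tau>]]
          by (intro card_inj_on_le[of "\<tau> \<circ> \<sigma>"]) (auto intro: inj_on_subset)
        then show False using True O by simp
      qed
      then show ?thesis by (simp add: sum.neutral)
    next
      case False
      have "\<exists>y. s < card {k \<in> ?V. row k = y}"
      proof (rule ccontr)
        assume "\<nexists>y. s < card {k \<in> ?V. row k = y}"
        then have "card ?V \<le> P * s"
          using row by (intro card_le_by_fibres[of ?V row]) (auto simp: not_less)
        with False show False by simp
      qed
      then obtain y where y: "s < card {k \<in> ?V. row k = y}" ..
      define W where "W = {k \<in> ?V. row k = y}"
      \<comment> \<open>\<open>L \<tau>\<close> consists of the positions of the odd variables of row \<open>y\<close>. The pair of positions to be exchanged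
      is chosen from \<open>L \<tau>\<close> and \<open>g\<close> alone; as the exchange preserves \<open>L \<tau>\<close>, it is an involution.\<close>
      define L where "L \<tau> = {i. i < n \<and> \<tau> (\<sigma> i) \<in> W}" for \<tau>
      define good where "good \<tau> e \<longleftrightarrow>
          fst e \<in> L \<tau> \<and> snd e \<in> L \<tau> \<and> fst e \<noteq> snd e \<and> g (fst e) = g (snd e) \<and> par (g (fst e)) = 1"
        for \<tau> e
      define pick where "pick \<tau> = (SOME e. good \<tau> e)" for \<tau>
      define h where "h \<tau> = (if \<exists>e. good \<tau> e
          then \<tau> \<circ> transpose (\<sigma> (fst (pick \<tau>))) (\<sigma> (snd (pick \<tau>))) else \<tau>)" for \<tau>
      have L_swap: "L (\<tau> \<circ> transpose (\<sigma> i) (\<sigma> j)) = L \<tau>" if "i \<in> L \<tau>" "j \<in> L \<tau>" for \<tau> i j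
      proof -
        have "transpose (\<sigma> i) (\<sigma> j) (\<sigma> k) = \<sigma> (transpose i j k)" for k
          using permutes_inj[OF perm[of \<sigma>]] \<sigma> by (auto simp: transpose_def inj_eq)
        then show ?thesis using that by (auto simp: L_def transpose_def)
      qed
      show ?thesis
      proof (rule sum_eq_zero_by_involution[where h = h])
        fix \<tau> assume \<tau>: "\<tau> \<in> ?R"
        note pv = comp[OF \<sigma> \<tau>]
        have "h \<tau> \<in> ?R \<and> h (h \<tau>) = \<tau> \<and>
            young_term p n m g (h \<tau> \<circ> \<sigma>) = - young_term p n m g (\<tau> \<circ> \<sigma>)"
        proof (cases "\<exists>e. good \<tau> e")
          case True
          define i j where "i = fst (pick \<tau>)" and "j = snd (pick \<tau>)"
          have "good \<tau> (pick \<tau>)"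
            unfolding pick_def using True by (rule someI_ex)
          then have ij: "i \<in> L \<tau>" "j \<in> L \<tau>" "i \<noteq> j" "g i = g j" "par (g i) = 1"
            by (auto simp: good_def i_def j_def)
          then have lt: "i < n" "j < n" by (auto simp: L_def)
          have h: "h \<tau> = \<tau> \<circ> transpose (\<sigma> i) (\<sigma> j)"
            using True by (simp add: h_def i_def j_def)
          have Lh: "L (h \<tau>) = L \<tau>"
            unfolding h using ij by (intro L_swap)
          then have "good (h \<tau>) = good \<tau>"
            by (simp add: good_def fun_eq_iff)
          then have hh: "h (h \<tau>) = h \<tau> \<circ> transpose (\<sigma> i) (\<sigma> j)"
            using True by (simp add: h_def pick_def i_def j_def)
          have "row (\<sigma> i) = row (\<sigma> j)"
            using ij \<tau> by (auto simp: L_def W_def fibre_permutations_def)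
          moreover have "\<sigma> i < n" "\<sigma> j < n"
            using permutes_in_image[OF perm[of \<sigma>]] \<sigma> lt by auto
          ultimately have "h \<tau> \<in> ?R"
            unfolding h using \<tau> by (intro fibre_permutations_compose transpose_in_fibre_permutations)
          moreover have "h (h \<tau>) = \<tau>"
            unfolding hh unfolding h by (simp add: comp_assoc)
          moreover have "transpose (\<sigma> i) (\<sigma> j) \<circ> \<sigma> = \<sigma> \<circ> transpose i j"
            using permutes_inj[OF perm[of \<sigma>]] \<sigma> by (auto simp: transpose_def inj_eq fun_eq_iff)
          then have "h \<tau> \<circ> \<sigma> = \<tau> \<circ> \<sigma> \<circ> transpose i j"
            unfolding h by (simp add: comp_assoc)
          then have "young_term p n m g (h \<tau> \<circ> \<sigma>) = - young_term p n m g (\<tau> \<circ> \<sigma>)"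
            using young_term_swap[of "\<tau> \<circ> \<sigma>" n i j g m p par] pv ij lt m by simp
          ultimately show ?thesis by blast
        next
          case nogood: False
          \<comment> \<open>No two positions of \<open>L \<tau>\<close> carry the same odd generator, but there are more than \<open>s\<close> of them.\<close>
          have "young_term p n m g (\<tau> \<circ> \<sigma>) = 0"
          proof (rule ccontr)
            assume "young_term p n m g (\<tau> \<circ> \<sigma>) \<noteq> 0"
            then have nz: "m ((\<tau> \<circ> \<sigma>) i) (g i) \<noteq> 0" if "i < n" for i
              using that by (auto simp: young_term_def prod_zero_iff)
            have odd: "par (g i) = 1" if "i \<in> L \<tau>" for i
              using m[OF nz[of i]] that by (auto simp: L_def W_def)
            have "card (L \<tau>) \<le> card (Inr ` {..<s} :: (nat + nat) set)"
            proof (rule card_inj_on_le)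
              show "inj_on g (L \<tau>)"
                using nogood odd by (fastforce simp: good_def inj_on_def)
              show "g ` L \<tau> \<subseteq> Inr ` {..<s}"
              proof
                fix x assume "x \<in> g ` L \<tau>"
                then obtain i where "x = g i" "i \<in> L \<tau>" by blast
                then have "x \<in> Inl ` {..<r} \<union> Inr ` {..<s}" "par x = 1"
                  using g odd by (auto simp: L_def)
                then show "x \<in> Inr ` {..<s}" using par by auto
              qed
            qed simp
            moreover have "L \<tau> = inv_into UNIV (\<tau> \<circ> \<sigma>) ` W"
            proof -
              have "L \<tau> = (\<tau> \<circ> \<sigma>) -` W"
                using permutes_in_image[OF pv] by (auto simp: L_def W_def)
              then show ?thesis
                using bij_vimage_eq_inv_image[OF permutes_bij[OF pv]] by simp
            qed
            then have "card (L \<tau>) = card W"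
              using permutes_inj[OF permutes_inv[OF pv]] by (simp add: card_image inj_on_subset)
            ultimately show False using y by (simp add: W_def card_image)
          qed
          then show ?thesis using nogood \<tau> by (simp add: h_def)
        qed
        then show "h \<tau> \<in> ?R" "h (h \<tau>) = \<tau>"
          "young_term p n m g (h \<tau> \<circ> \<sigma>) = - young_term p n m g (\<tau> \<circ> \<sigma>)"
          by blast+
      qed
    qed
    then show ?thesis by (simp add: sum_distrib_left[symmetric])
  qed
qed

lemma fibre_permutations_Int_trivial:
  assumes "inj_on (\<lambda>i. (row i, col i)) {..<n}"
    and v: "v \<in> fibre_permutations n col" and "\<And>i. i < n \<Longrightarrow> row (v i) = row i"
  shows "v = id"
proof
  fix i
  have pv: "v permutes {..<n}" using v by (simp add: fibre_permutations_def)
  show "v i = id i"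
  proof (cases "i < n")
    case True
    then have "v i < n" using permutes_in_image[OF pv] by simp
    then show ?thesis
      using inj_onD[OF assms(1), of "v i" i] True assms v by (auto simp: fibre_permutations_def)
  next
    case False
    then show ?thesis using permutes_not_in[OF pv, of i] by simp
  qed
qed

text \<open>
  All generators are even, so no Koszul signs occur. A term does not vanish iff \<open>\<sigma>\<close> preserves rows, that is
  iff \<open>\<sigma>\<close> is the identity, and then it equals \<open>1\<close> for each row permutation \<open>\<tau>\<close>.
\<close>
lemma young_sum_rows:
  fixes m :: "nat \<Rightarrow> 'g \<Rightarrow> 'k::field_char_0"
  assumes inj: "inj_on (\<lambda>i. (row i, col i)) {..<n}"
    and m: "\<And>k x. k < n \<Longrightarrow> m k x = (if x = e (row k) then 1 else 0)" and e: "inj e"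
  shows "(\<Sum>\<sigma>\<in>fibre_permutations n col. \<Sum>\<tau>\<in>fibre_permutations n row.
    of_int (sign \<sigma>) * young_term (\<lambda>_. 0) n m (e \<circ> row) (\<tau> \<circ> \<sigma>)) \<noteq> 0"
proof -
  let ?C = "fibre_permutations n col" and ?R = "fibre_permutations n row"
  have summand: "of_int (sign \<sigma>) * young_term (\<lambda>_. 0) n m (e \<circ> row) (\<tau> \<circ> \<sigma>) = (if \<sigma> = id then 1 else 0)"
    if \<sigma>: "\<sigma> \<in> ?C" and \<tau>: "\<tau> \<in> ?R" for \<sigma> \<tau>
  proof -
    have "\<tau> (\<sigma> i) < n" if "i < n" for i
      using \<sigma> \<tau> that permutes_in_image[of \<sigma> "{..<n}"] permutes_in_image[of \<tau> "{..<n}"]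
      by (auto simp: fibre_permutations_def)
    then have *: "m ((\<tau> \<circ> \<sigma>) i) ((e \<circ> row) i) = (if row i = row (\<sigma> i) then 1 else 0)" if "i < n" for i
      using that m \<tau> e by (auto simp: fibre_permutations_def inj_eq)
    have k: "koszul_sign (\<lambda>_. 0) xs = (1::'k)" for xs
      by (simp add: koszul_sign_def)
    show ?thesis
    proof (cases "\<sigma> = id")
      case True
      then show ?thesis using * by (simp add: young_term_def k)
    next
      case False
      then obtain i where "i < n" "row (\<sigma> i) \<noteq> row i"
        using fibre_permutations_Int_trivial[OF inj \<sigma>] by blast
      then show ?thesis using False * by (auto simp: young_term_def prod_zero_iff intro!: bexI[of _ i])
    qed
  qed
  have "(\<Sum>\<sigma>\<in>?C. \<Sum>\<tau>\<in>?R. of_int (sign \<sigma>) * young_term (\<lambda>_. 0) n m (e \<circ> row) (\<tau> \<circ> \<sigma>)) =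
      (\<Sum>\<sigma>\<in>?C. if \<sigma> = id then of_nat (card ?R) else 0)"
    using summand by (intro sum.cong refl) (simp cong: sum.cong)
  also have "\<dots> = of_nat (card ?R)"
    by (simp)
  also have "\<dots> \<noteq> 0"
    using id_in_fibre_permutations[of n row] by (auto simp: card_eq_0_iff simp del: id_in_fibre_permutations)
  finally show ?thesis .
qed

text \<open>
  The roles of \<open>\<sigma>\<close> and \<open>\<tau>\<close> are exchanged: a term does not vanish iff \<open>\<tau>\<close> is the identity. All generators
  are odd, so the Koszul sign of the term is that of \<open>\<sigma>\<close> up to the common factor \<open>K\<close>, and it cancels the sign with
  which \<open>\<sigma>\<close> enters the sum.
\<close>
lemma young_sum_columns:
  fixes m :: "nat \<Rightarrow> 'g \<Rightarrow> 'k::field_char_0"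
  assumes inj: "inj_on (\<lambda>i. (row i, col i)) {..<n}"
    and m: "\<And>k x. k < n \<Longrightarrow> m k x = (if x = e (col k) then 1 else 0)" and e: "inj e"
  shows "(\<Sum>\<sigma>\<in>fibre_permutations n col. \<Sum>\<tau>\<in>fibre_permutations n row.
    of_int (sign \<sigma>) * young_term (\<lambda>_. 1) n m (e \<circ> col) (\<tau> \<circ> \<sigma>)) \<noteq> 0"
proof -
  let ?C = "fibre_permutations n col" and ?R = "fibre_permutations n row"
  define K :: 'k where "K = koszul_sign (\<lambda>_. 1) ([0, 1] @ map (\<lambda>i. i + 2) [0..<n])"
  have "K \<noteq> 0" by (simp add: K_def koszul_sign_def)
  have inj': "inj_on (\<lambda>i. (col i, row i)) {..<n}"
    using inj by (auto simp: inj_on_def)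
  have summand: "of_int (sign \<sigma>) * young_term (\<lambda>_. 1) n m (e \<circ> col) (\<tau> \<circ> \<sigma>) = (if \<tau> = id then K else 0)"
    if \<sigma>: "\<sigma> \<in> ?C" and \<tau>: "\<tau> \<in> ?R" for \<sigma> \<tau>
  proof -
    have p\<sigma>: "\<sigma> permutes {..<n}" and p\<tau>: "\<tau> permutes {..<n}"
      using \<sigma> \<tau> by (auto simp: fibre_permutations_def)
    have lt: "\<tau> (\<sigma> i) < n" "\<sigma> i < n" if "i < n" for i
      using that permutes_in_image[OF p\<sigma>] permutes_in_image[OF p\<tau>] by auto
    have *: "m ((\<tau> \<circ> \<sigma>) i) ((e \<circ> col) i) = (if col (\<tau> (\<sigma> i)) = col (\<sigma> i) then 1 else 0)"
      if "i < n" for i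
      using that m \<sigma> e lt by (auto simp: fibre_permutations_def inj_eq)
    show ?thesis
    proof (cases "\<tau> = id")
      case True
      have "koszul_sign (\<lambda>_. 1) ([0, 1] @ map (\<lambda>i. \<sigma> i + 2) [0..<n]) = of_int (sign \<sigma>) * K"
        using koszul_sign_all_odd[OF p\<sigma>, of "\<lambda>_. 1" "[0, 1]" "\<lambda>i. i + 2"]
        by (auto simp: K_def o_def inj_def)
      moreover have "of_int (sign \<sigma>) * (of_int (sign \<sigma>) * K) = K"
        by (cases \<sigma> rule: sign_cases) auto
      ultimately show ?thesis using True * by (simp add: young_term_def)
    next
      case False
      then obtain k where k: "k < n" "col (\<tau> k) \<noteq> col k"
        using fibre_permutations_Int_trivial[OF inj' \<tau>] by blast
      obtain i where "i < n" "\<sigma> i = k"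
        using k permutes_image[OF p\<sigma>] by (metis imageE lessThan_iff)
      then show ?thesis using False * k by (auto simp: young_term_def prod_zero_iff intro!: bexI[of _ i])
    qed
  qed
  have "(\<Sum>\<sigma>\<in>?C. \<Sum>\<tau>\<in>?R. of_int (sign \<sigma>) * young_term (\<lambda>_. 1) n m (e \<circ> col) (\<tau> \<circ> \<sigma>)) =
      (\<Sum>\<sigma>\<in>?C. \<Sum>\<tau>\<in>?R. if \<tau> = id then K else 0)"
    using summand by (intro sum.cong refl)
  also have "\<dots> = of_nat (card ?C) * K"
    by (simp)
  also have "\<dots> \<noteq> 0"
    using \<open>K \<noteq> 0\<close> id_in_fibre_permutations[of n col]
    by (auto simp: card_eq_0_iff simp del: id_in_fibre_permutations)
  finally show ?thesis .
qed

section \<open>Nonassociative algebras\<close>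

lemma scalars_simps [simp]:
  "carrier scalars = UNIV" "x \<otimes>\<^bsub>scalars\<^esub> y = x * y" "x \<oplus>\<^bsub>scalars\<^esub> y = x + y"
  "\<one>\<^bsub>scalars\<^esub> = 1" "\<zero>\<^bsub>scalars\<^esub> = 0"
  by (simp_all add: ring_of_type_algebra_def)

lemma nonassoc_algebraI:
  fixes A :: "('k::field, 'a, 'm) module_scheme" (structure)
  assumes "\<And>x y. x \<in> carrier A \<Longrightarrow> y \<in> carrier A \<Longrightarrow> x \<oplus> y \<in> carrier A"
    and "\<zero> \<in> carrier A"
    and "\<And>x y z. x \<in> carrier A \<Longrightarrow> y \<in> carrier A \<Longrightarrow> z \<in> carrier A \<Longrightarrow> (x \<oplus> y) \<oplus> z = x \<oplus> (y \<oplus> z)"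
    and "\<And>x y. x \<in> carrier A \<Longrightarrow> y \<in> carrier A \<Longrightarrow> x \<oplus> y = y \<oplus> x"
    and "\<And>x. x \<in> carrier A \<Longrightarrow> \<zero> \<oplus> x = x"
    and "\<And>x. x \<in> carrier A \<Longrightarrow> \<exists>y \<in> carrier A. y \<oplus> x = \<zero>"
    and "\<And>c x. x \<in> carrier A \<Longrightarrow> c \<odot> x \<in> carrier A"
    and "\<And>c d x. x \<in> carrier A \<Longrightarrow> (c + d) \<odot> x = c \<odot> x \<oplus> d \<odot> x"
    and "\<And>c x y. x \<in> carrier A \<Longrightarrow> y \<in> carrier A \<Longrightarrow> c \<odot> (x \<oplus> y) = c \<odot> x \<oplus> c \<odot> y"
    and "\<And>c d x. x \<in> carrier A \<Longrightarrow> (c * d) \<odot> x = c \<odot> (d \<odot> x)"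
    and "\<And>x. x \<in> carrier A \<Longrightarrow> 1 \<odot> x = x"
    and "\<And>x y. x \<in> carrier A \<Longrightarrow> y \<in> carrier A \<Longrightarrow> x \<otimes> y \<in> carrier A"
    and "\<And>x y z. x \<in> carrier A \<Longrightarrow> y \<in> carrier A \<Longrightarrow> z \<in> carrier A \<Longrightarrow> (x \<oplus> y) \<otimes> z = x \<otimes> z \<oplus> y \<otimes> z"
    and "\<And>x y z. x \<in> carrier A \<Longrightarrow> y \<in> carrier A \<Longrightarrow> z \<in> carrier A \<Longrightarrow> z \<otimes> (x \<oplus> y) = z \<otimes> x \<oplus> z \<otimes> y"
    and "\<And>c x y. x \<in> carrier A \<Longrightarrow> y \<in> carrier A \<Longrightarrow> (c \<odot> x) \<otimes> y = c \<odot> (x \<otimes> y)"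
    and "\<And>c x y. x \<in> carrier A \<Longrightarrow> y \<in> carrier A \<Longrightarrow> x \<otimes> (c \<odot> y) = c \<odot> (x \<otimes> y)"
  shows "nonassoc_algebra A"
proof (intro nonassoc_algebra.intro moduleI nonassoc_algebra_axioms.intro)
  show "cring (scalars :: 'k ring)" by (rule cring_from_type_algebra)
  show "abelian_group A" by (rule abelian_groupI) (use assms in auto)
qed (use assms in auto)

context nonassoc_algebra
begin

lemma smult_0 [simp]: "x \<in> carrier A \<Longrightarrow> 0 \<odot> x = \<zero>"
  using smult_l_null by simp

lemma smult_1 [simp]: "x \<in> carrier A \<Longrightarrow> 1 \<odot> x = x"
  using smult_one by simp

lemma smult_zero [simp]: "c \<odot> \<zero> = \<zero>"
  using smult_r_null by simp

lemma smult_carrier [simp]: "x \<in> carrier A \<Longrightarrow> c \<odot> x \<in> carrier A"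
  using smult_closed by simp

lemma smult_add_left: "x \<in> carrier A \<Longrightarrow> (c + d) \<odot> x = c \<odot> x \<oplus> d \<odot> x"
  using smult_l_distr by simp

lemma smult_add_right: "x \<in> carrier A \<Longrightarrow> y \<in> carrier A \<Longrightarrow> c \<odot> (x \<oplus> y) = c \<odot> x \<oplus> c \<odot> y"
  using smult_r_distr by simp

lemma smult_smult: "x \<in> carrier A \<Longrightarrow> c \<odot> (d \<odot> x) = (c * d) \<odot> x"
  using smult_assoc1[of c d x] by simp

text \<open>
  Over a field closure under inverses comes from multiplication by \<open>- 1\<close>.
\<close>
lemma subspaceI:
  assumes "H \<subseteq> carrier A" "\<zero> \<in> H" "\<And>x y. x \<in> H \<Longrightarrow> y \<in> H \<Longrightarrow> x \<oplus> y \<in> H"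
    "\<And>c x. x \<in> H \<Longrightarrow> c \<odot> x \<in> H"
  shows "submodule H scalars A"
proof (rule submoduleI)
  fix x assume x: "x \<in> H"
  then have "x \<in> carrier A" using assms(1) by blast
  then have "(- 1) \<odot> x \<oplus> x = \<zero>"
    using smult_add_left[of x "- 1" 1] by simp
  then have "\<ominus> x = (- 1) \<odot> x"
    using \<open>x \<in> carrier A\<close> by (intro M.minus_equality) auto
  then show "\<ominus> x \<in> H" using assms(4)[OF x] by simp
qed (use assms in auto)

lemma submoduleD:
  assumes "submodule H scalars A"
  shows "H \<subseteq> carrier A" "\<zero> \<in> H" "\<And>x y. x \<in> H \<Longrightarrow> y \<in> H \<Longrightarrow> x \<oplus> y \<in> H"
    "\<And>c x. x \<in> H \<Longrightarrow> c \<odot> x \<in> H" "\<And>x. x \<in> H \<Longrightarrow> \<ominus> x \<in> H"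
proof -
  show "\<zero> \<in> H"
    using subgroup.one_closed[OF submodule.axioms(1)[OF assms]] by simp
qed (use submoduleE[OF assms] in auto)

lemma submodule_finsum:
  assumes "submodule H scalars A" "finite S" "\<And>i. i \<in> S \<Longrightarrow> f i \<in> H"
  shows "(\<Oplus>i\<in>S. f i) \<in> H"
  using assms(2,3)
proof (induction S rule: finite_induct)
  case (insert i S)
  then have "f \<in> S \<rightarrow> carrier A" "f i \<in> carrier A"
    using submoduleD(1)[OF assms(1)] by auto
  then show ?case using insert submoduleD(3)[OF assms(1)] by simp
qed (simp add: submoduleD(2)[OF assms(1)])

lemma mult_zero [simp]:
  "x \<in> carrier A \<Longrightarrow> \<zero> \<otimes> x = \<zero>" "x \<in> carrier A \<Longrightarrow> x \<otimes> \<zero> = \<zero>"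
  using mult_smult_left[of \<zero> x 0] mult_smult_right[of x \<zero> 0] mult_closed by auto

lemma finsum_mult_left:
  assumes "finite S" "f \<in> S \<rightarrow> carrier A" "y \<in> carrier A"
  shows "(\<Oplus>i\<in>S. f i) \<otimes> y = (\<Oplus>i\<in>S. f i \<otimes> y)"
  using assms
proof (induction S rule: finite_induct)
  case (insert i S)
  have "(\<lambda>i. f i \<otimes> y) \<in> S \<rightarrow> carrier A" using insert.prems mult_closed by auto
  then show ?case using insert by (simp add: mult_closed mult_add_left)
qed simp

lemma finsum_mult_right:
  assumes "finite S" "f \<in> S \<rightarrow> carrier A" "y \<in> carrier A"
  shows "y \<otimes> (\<Oplus>i\<in>S. f i) = (\<Oplus>i\<in>S. y \<otimes> f i)"
  using assms
proof (induction S rule: finite_induct)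
  case (insert i S)
  have "(\<lambda>i. y \<otimes> f i) \<in> S \<rightarrow> carrier A" using insert.prems mult_closed by auto
  then show ?case using insert by (simp add: mult_closed mult_add_right)
qed simp

lemma satisfies_metabelian_iff:
  "satisfies A metabelian_poly \<longleftrightarrow>
    (\<forall>x\<in>carrier A. \<forall>y\<in>carrier A. \<forall>z\<in>carrier A. \<forall>t\<in>carrier A. (x \<otimes> y) \<otimes> (z \<otimes> t) = \<zero>)"
proof -
  have eval: "eval_poly A a metabelian_poly = (a 0 \<otimes> a 1) \<otimes> (a 2 \<otimes> a 3)"
    if "range a \<subseteq> carrier A" for a
  proof -
    have "a i \<in> carrier A" for i using that by auto
    then show ?thesis by (simp add: eval_poly_def metabelian_poly_def mult_closed)
  qed
  show ?thesis
  proof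
    assume sat: "satisfies A metabelian_poly"
    show "\<forall>x\<in>carrier A. \<forall>y\<in>carrier A. \<forall>z\<in>carrier A. \<forall>t\<in>carrier A. (x \<otimes> y) \<otimes> (z \<otimes> t) = \<zero>"
    proof (intro ballI)
      fix x y z t assume xyzt: "x \<in> carrier A" "y \<in> carrier A" "z \<in> carrier A" "t \<in> carrier A"
      let ?a = "\<lambda>i::nat. if i = 0 then x else if i = 1 then y else if i = 2 then z else t"
      have "range ?a \<subseteq> carrier A" using xyzt by auto
      then show "(x \<otimes> y) \<otimes> (z \<otimes> t) = \<zero>"
        using sat eval[of ?a] by (simp add: satisfies_def)
    qed
  next
    assume "\<forall>x\<in>carrier A. \<forall>y\<in>carrier A. \<forall>z\<in>carrier A. \<forall>t\<in>carrier A. (x \<otimes> y) \<otimes> (z \<otimes> t) = \<zero>"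
    then show "satisfies A metabelian_poly"
      unfolding satisfies_def using eval by (simp add: subset_iff)
  qed
qed

end

lemma eval_word_closed:
  assumes "nonassoc_algebra A" "\<And>x. a x \<in> carrier A"
  shows "eval_word A a w \<in> carrier A"
  by (induction w) (auto simp: assms nonassoc_algebra.mult_closed)

lemma super_eval_closed:
  assumes "nonassoc_algebra A" "\<And>v. a v \<in> carrier A"
  shows "super_eval A p a f \<in> carrier A"
proof -
  interpret nonassoc_algebra A by (rule assms(1))
  show ?thesis
    unfolding super_eval_def
    using eval_word_closed[of A a] assms
    by (intro submodule_finsum[OF carrier_is_submodule]) auto
qed

context superalgebra
begin

lemma component_closed: "x \<in> component A i \<Longrightarrow> x \<in> carrier A"
  using submoduleD(1)[OF component_submodule] by blast

lemmas component_zero = submoduleD(2)[OF component_submodule]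
  and component_add = submoduleD(3)[OF component_submodule]
  and component_smult = submoduleD(4)[OF component_submodule]
  and component_minus = submoduleD(5)[OF component_submodule]

end

section \<open>Homomorphic images\<close>

text \<open>
  \<open>B\<close> is a bare record, not yet known to be a superalgebra: all axioms pass to images, except that the
  components of the image meet in zero, which is the last assumption. It says that the kernel is
  graded.
\<close>
locale superalgebra_epimorphism = superalgebra A
  for A :: "('k::field, 'a, 'm) superalgebra_scheme" (structure) +
  fixes B :: "('k, 'b, 'n) superalgebra_scheme" and \<phi> :: "'a \<Rightarrow> 'b"
  assumes carrier_image: "carrier B = \<phi> ` carrier A"
    and component_image: "component B i = \<phi> ` component A i"
    and hom_add: "\<lbrakk>x \<in> carrier A; y \<in> carrier A\<rbrakk> \<Longrightarrow> \<phi> (x \<oplus> y) = \<phi> x \<oplus>\<^bsub>B\<^esub> \<phi> y"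
    and hom_mult: "\<lbrakk>x \<in> carrier A; y \<in> carrier A\<rbrakk> \<Longrightarrow> \<phi> (x \<otimes> y) = \<phi> x \<otimes>\<^bsub>B\<^esub> \<phi> y"
    and hom_smult: "x \<in> carrier A \<Longrightarrow> \<phi> (c \<odot> x) = c \<odot>\<^bsub>B\<^esub> \<phi> x"
    and hom_zero: "\<phi> \<zero> = \<zero>\<^bsub>B\<^esub>"
    and kernel_graded: "\<lbrakk>x \<in> component A 0; y \<in> component A 1; \<phi> x = \<phi> y\<rbrakk> \<Longrightarrow> \<phi> x = \<zero>\<^bsub>B\<^esub>"
begin

lemma image_nonassoc_algebra: "nonassoc_algebra B"
  by (rule nonassoc_algebraI)
    (auto simp: carrier_image hom_add[symmetric] hom_mult[symmetric] hom_smult[symmetric]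
      hom_zero[symmetric] M.a_ac M.r_neg smult_add_left smult_add_right
      smult_smult mult_closed mult_add_left mult_add_right
      mult_smult_left mult_smult_right intro!: imageI bexI[of _ "\<ominus> _"])

lemma image_superalgebra: "superalgebra B"
proof -
  interpret B: nonassoc_algebra B by (rule image_nonassoc_algebra)
  show ?thesis
  proof (intro superalgebra.intro superalgebra_axioms.intro)
    show "nonassoc_algebra B" by (rule image_nonassoc_algebra)
  next
    fix i
    show "submodule (component B i) scalars B"
      unfolding component_image
    proof (rule B.subspaceI)
      show "\<phi> ` component A i \<subseteq> carrier B"
        using component_closed by (auto simp: carrier_image)
      show "\<zero>\<^bsub>B\<^esub> \<in> \<phi> ` component A i"
        unfolding hom_zero[symmetric] using component_zero by (rule imageI)
    qed (auto simp: hom_add[symmetric] hom_smult[symmetric] component_closed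
        intro!: imageI component_add component_smult)
  next
    have "component B 0 <+>\<^bsub>B\<^esub> component B 1 = \<phi> ` (component A 0 <+> component A 1)"
      unfolding set_add_def' component_image
      by (auto simp: hom_add component_closed) (auto simp: hom_add[symmetric] component_closed)
    then show "component B 0 <+>\<^bsub>B\<^esub> component B 1 = carrier B"
      by (simp add: component_sum carrier_image)
  next
    have "\<zero>\<^bsub>B\<^esub> \<in> component B i" for i
      unfolding component_image hom_zero[symmetric] using component_zero by (rule imageI)
    moreover have "x = \<zero>\<^bsub>B\<^esub>" if "x \<in> component B 0" "x \<in> component B 1" for x
      using that kernel_graded unfolding component_image by (metis imageE)
    ultimately show "component B 0 \<inter> component B 1 = {\<zero>\<^bsub>B\<^esub>}" by auto
  next
    fix x y i j assume "x \<in> component B i" "y \<in> component B j"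
    then show "x \<otimes>\<^bsub>B\<^esub> y \<in> component B (i + j)"
      unfolding component_image
      by (auto simp: hom_mult[symmetric] component_closed simp del: add_bit_eq_xor
          intro!: imageI component_mult)
  qed
qed

lemma hom_finsum:
  assumes "finite S" "f \<in> S \<rightarrow> carrier A"
  shows "\<phi> (\<Oplus>i\<in>S. f i) = (\<Oplus>\<^bsub>B\<^esub>i\<in>S. \<phi> (f i))"
proof -
  interpret B: nonassoc_algebra B by (rule image_nonassoc_algebra)
  show ?thesis using assms
  proof (induction S rule: finite_induct)
    case (insert i S)
    then have "(\<lambda>i. \<phi> (f i)) \<in> S \<rightarrow> carrier B" "\<phi> (f i) \<in> carrier B"
      by (auto simp: carrier_image)
    then show ?case using insert by (simp add: hom_add)
  qed (simp add: hom_zero)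
qed

lemma hom_eval_word:
  assumes "\<And>x. a x \<in> carrier A"
  shows "\<phi> (eval_word A a w) = eval_word B (\<lambda>x. \<phi> (a x)) w"
proof (induction w)
  case (Prod u v)
  then show ?case
    using eval_word_closed[of A a] nonassoc_algebra_axioms assms by (simp add: hom_mult)
qed simp

lemma hom_super_eval:
  assumes "\<And>x :: nat. a x \<in> carrier A"
  shows "\<phi> (super_eval A p a f) = super_eval B p (\<lambda>x. \<phi> (a x)) f"
proof -
  interpret B: nonassoc_algebra B by (rule image_nonassoc_algebra)
  have closed: "eval_word A a w \<in> carrier A" for w
    using eval_word_closed[of A a] nonassoc_algebra_axioms assms by blast
  have "\<phi> (super_eval A p a f) = (\<Oplus>\<^bsub>B\<^esub>w\<in>Poly_Mapping.keys f.
      \<phi> ((koszul_sign p (letters w) * Poly_Mapping.lookup f w) \<odot> eval_word A a w))"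
    unfolding super_eval_def by (rule hom_finsum) (use closed in auto)
  also have "\<dots> = super_eval B p (\<lambda>x. \<phi> (a x)) f"
    unfolding super_eval_def by (simp add: hom_smult hom_eval_word assms closed)
  finally show ?thesis .
qed

text \<open>
  Homogeneous elements of the image lift to homogeneous elements of the same parity, so superidentities of
  an image can be tested upstairs, modulo the kernel.
\<close>
lemma super_satisfies_image_iff:
  "super_satisfies B f \<longleftrightarrow>
    (\<forall>p a. (\<forall>v. a v \<in> component A (p v)) \<longrightarrow> \<phi> (super_eval A p a f) = \<zero>\<^bsub>B\<^esub>)"
proof
  assume "super_satisfies B f"
  then show "\<forall>p a. (\<forall>v. a v \<in> component A (p v)) \<longrightarrow> \<phi> (super_eval A p a f) = \<zero>\<^bsub>B\<^esub>"
    unfolding super_satisfies_def component_image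
    using hom_super_eval component_closed by (metis imageI)
next
  assume *: "\<forall>p a. (\<forall>v. a v \<in> component A (p v)) \<longrightarrow> \<phi> (super_eval A p a f) = \<zero>\<^bsub>B\<^esub>"
  show "super_satisfies B f"
    unfolding super_satisfies_def
  proof (intro allI impI)
    fix p :: "nat \<Rightarrow> bit" and b assume "\<forall>v. b v \<in> component B (p v)"
    then have "\<forall>v. \<exists>x. x \<in> component A (p v) \<and> b v = \<phi> x"
      unfolding component_image by blast
    then obtain a where a: "\<And>v. a v \<in> component A (p v)" "\<And>v. b v = \<phi> (a v)" by metis
    have "b = (\<lambda>v. \<phi> (a v))" using a(2) by blast
    then show "super_eval B p b f = \<zero>\<^bsub>B\<^esub>"
      using * a(1) hom_super_eval[of a p f] component_closed by metis
  qed
qed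

end

text \<open>
  Transport of structure.
\<close>
lemma (in superalgebra) embedding_into_type:
  fixes g :: "'a \<Rightarrow> 'u"
  assumes inj: "inj_on g (carrier A)"
  obtains B :: "('k, 'u) superalgebra" where
    "superalgebra_epimorphism A B g"
proof
  let ?g = "inv_into (carrier A) g"
  let ?B = "\<lparr>carrier = g ` carrier A, monoid.mult = (\<lambda>x y. g (?g x \<otimes> ?g y)),
    monoid.one = undefined, ring.zero = g \<zero>, ring.add = (\<lambda>x y. g (?g x \<oplus> ?g y)),
    module.smult = (\<lambda>c x. g (c \<odot> ?g x)), component = (\<lambda>i. g ` component A i)\<rparr>"
  show "superalgebra_epimorphism A ?B g"
  proof
    fix x y assume xy: "x \<in> component A 0" "y \<in> component A 1" "g x = g y"
    then have "x = y" using inj component_closed by (auto dest: inj_onD)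
    then have "x \<in> component A 0 \<inter> component A 1" using xy by simp
    then show "g x = \<zero>\<^bsub>?B\<^esub>" unfolding component_disjoint by simp
  qed (auto simp: inj)
qed

section \<open>Quotients\<close>

context graded_ideal
begin

lemma abelian_subgroup: "abelian_subgroup I A"
  by (intro abelian_subgroupI3 additive_subgroup.intro M.abelian_group_axioms subgroup_axioms)

lemma coset_eqI:
  assumes "h \<in> I" "x \<in> carrier A"
  shows "I +> (h \<oplus> x) = I +> x"
  by (rule abelian_subgroup.a_repr_independence'[OF abelian_subgroup, symmetric])
    (use assms in \<open>auto simp: a_r_coset_def'\<close>)

lemma coset_mult:
  assumes x: "x \<in> carrier A" and y: "y \<in> carrier A"
  shows "rcoset_mult A I (I +> x) (I +> y) = I +> (x \<otimes> y)"
proof -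
  note D = submoduleD[OF submodule_axioms]
  have eq: "I +> (a \<otimes> b) = I +> (x \<otimes> y)" if a: "a \<in> I +> x" and b: "b \<in> I +> y" for a b
  proof -
    obtain h where h: "h \<in> I" "a = h \<oplus> x" using a by (auto simp: a_r_coset_def')
    obtain k where k: "k \<in> I" "b = k \<oplus> y" using b by (auto simp: a_r_coset_def')
    have hk: "h \<in> carrier A" "k \<in> carrier A" using h k D(1) by auto
    then have "a \<otimes> b = (h \<otimes> k \<oplus> x \<otimes> k \<oplus> h \<otimes> y) \<oplus> x \<otimes> y"
      using x y by (simp add: h(2) k(2) mult_add_left mult_add_right mult_closed M.a_assoc)
    moreover have "h \<otimes> k \<oplus> x \<otimes> k \<oplus> h \<otimes> y \<in> I"
      using h k x y hk by (intro D(3) ideal_left ideal_right)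
    ultimately show ?thesis using x y by (simp add: coset_eqI mult_closed)
  qed
  have "x \<in> I +> x" "y \<in> I +> y"
    using abelian_subgroup.a_rcos_self[OF abelian_subgroup] x y by auto
  then show ?thesis unfolding rcoset_mult_def using eq by blast
qed

lemma coset_smult:
  assumes x: "x \<in> carrier A"
  shows "(\<Union>y \<in> I +> x. I +> (c \<odot> y)) = I +> (c \<odot> x)"
proof -
  note D = submoduleD[OF submodule_axioms]
  have eq: "I +> (c \<odot> y) = I +> (c \<odot> x)" if "y \<in> I +> x" for y
  proof -
    obtain h where h: "h \<in> I" "y = h \<oplus> x" using \<open>y \<in> I +> x\<close> by (auto simp: a_r_coset_def')
    then have "h \<in> carrier A" using D(1) by blast
    then have "c \<odot> y = c \<odot> h \<oplus> c \<odot> x"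
      unfolding h(2) using x by (rule smult_add_right)
    then show ?thesis using x h D(4) by (simp add: coset_eqI)
  qed
  have "x \<in> I +> x"
    using abelian_subgroup.a_rcos_self[OF abelian_subgroup] x by auto
  then show ?thesis using eq by blast
qed

lemma coset_eq_zero_iff:
  assumes x: "x \<in> carrier A"
  shows "I +> x = I \<longleftrightarrow> x \<in> I"
proof
  assume "I +> x = I"
  then show "x \<in> I" using abelian_subgroup.a_rcos_self[OF abelian_subgroup x] by simp
next
  assume "x \<in> I"
  then show "I +> x = I"
    using coset_eqI[of x \<zero>] x submoduleD(1)[OF submodule_axioms] by simp
qed

lemma quotient_epimorphism: "superalgebra_epimorphism A (quotient_superalgebra A I) (\<lambda>x. I +> x)"
proof
  note D = submoduleD[OF submodule_axioms]
  fix x y assume xy: "x \<in> component A 0" "y \<in> component A 1" "I +> x = I +> y"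
  then have c: "x \<in> carrier A" "y \<in> carrier A" by (auto simp: component_closed)
  have "x \<in> I +> y"
    using xy c abelian_subgroup.a_rcos_self[OF abelian_subgroup, of x] by simp
  then obtain h where h: "h \<in> I" "x = h \<oplus> y" by (auto simp: a_r_coset_def')
  then obtain u v where uv: "u \<in> I" "u \<in> component A 0" "v \<in> I" "v \<in> component A 1" "h = u \<oplus> v"
    using ideal_graded unfolding set_add_def' by blast
  then have cuv: "u \<in> carrier A" "v \<in> carrier A" by (auto simp: component_closed)
  \<comment> \<open>Homogeneous parts of different parity that are congruent modulo a graded ideal lie in the ideal.\<close>
  have "x \<oplus> \<ominus> u = v \<oplus> y"
    using h uv c cuv by (simp add: M.a_ac) (metis M.a_assoc M.a_inv_closed M.a_lcomm M.add.m_closed M.r_neg M.r_zero)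
  moreover have "x \<oplus> \<ominus> u \<in> component A 0" "v \<oplus> y \<in> component A 1"
    using xy uv by (auto intro: component_add component_minus)
  ultimately have "x \<oplus> \<ominus> u = \<zero>" using component_disjoint by auto
  moreover have "x = (x \<oplus> \<ominus> u) \<oplus> u" using c cuv by (simp add: M.a_assoc M.l_neg)
  ultimately have "x = u" using cuv by simp
  then show "I +> x = \<zero>\<^bsub>quotient_superalgebra A I\<^esub>"
    using uv c coset_eq_zero_iff by (simp add: quotient_superalgebra_def)
next
  show "I +> \<zero> = \<zero>\<^bsub>quotient_superalgebra A I\<^esub>"
    using coset_eq_zero_iff submoduleD(2)[OF submodule_axioms]
    by (simp add: quotient_superalgebra_def)
qed (auto simp: quotient_superalgebra_def A_RCOSETS_def' coset_mult coset_smult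
    abelian_subgroup.a_rcos_sum[OF abelian_subgroup])

text \<open>
  Together with an injection of the elements of the algebra into a type, this places the quotient on the same type.
\<close>
lemma inj_on_representative: "inj_on (\<lambda>C. SOME x. x \<in> C) (carrier (quotient_superalgebra A I))"
proof (rule inj_onI)
  have pick: "x \<in> carrier A" "C = I +> x"
    if C: "C \<in> carrier (quotient_superalgebra A I)" and x: "x = (SOME x. x \<in> C)" for C x
  proof -
    obtain y where y: "y \<in> carrier A" "C = I +> y"
      using C by (auto simp: quotient_superalgebra_def A_RCOSETS_def')
    then have "y \<in> C" using abelian_subgroup.a_rcos_self[OF abelian_subgroup] by simp
    then have "x \<in> C" unfolding x by (rule someI)
    then show "C = I +> x" "x \<in> carrier A"
      using abelian_subgroup.a_repr_independence'[OF abelian_subgroup, of x y] y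
        abelian_subgroup.a_elemrcos_carrier[OF abelian_subgroup, of y x] by auto
  qed
  fix C D assume "C \<in> carrier (quotient_superalgebra A I)" "D \<in> carrier (quotient_superalgebra A I)"
    "(SOME x. x \<in> C) = (SOME x. x \<in> D)"
  then show "C = D" using pick(2) by metis
qed

end

section \<open>Grassmann envelopes\<close>

context superalgebra
begin

lemma envelope_carrier_iff:
  "h \<in> carrier (grassmann_envelope A) \<longleftrightarrow> finite {S. h S \<noteq> \<zero>} \<and>
    (\<forall>S. if finite S then h S \<in> component A (of_nat (card S)) else h S = \<zero>)"
  by (simp add: grassmann_envelope_def)

lemma envelope_component:
  "h \<in> carrier (grassmann_envelope A) \<Longrightarrow> finite S \<Longrightarrow> h S \<in> component A (of_nat (card S))"
  unfolding envelope_carrier_iff by metis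

lemma envelope_closed [simp]: "h \<in> carrier (grassmann_envelope A) \<Longrightarrow> h S \<in> carrier A"
  unfolding envelope_carrier_iff using component_closed M.zero_closed by metis

lemma envelope_mult:
  "finite U \<Longrightarrow> (h \<otimes>\<^bsub>grassmann_envelope A\<^esub> g) U =
    (\<Oplus>S\<in>Pow U. grassmann_sign S (U - S) \<odot> (h S \<otimes> g (U - S)))"
  by (simp add: grassmann_envelope_def)

lemma envelope_mult_infinite:
  "infinite U \<Longrightarrow> (h \<otimes>\<^bsub>grassmann_envelope A\<^esub> g) U = \<zero>"
  by (simp add: grassmann_envelope_def)

lemma envelope_simps [simp]:
  "(h \<oplus>\<^bsub>grassmann_envelope A\<^esub> g) S = h S \<oplus> g S"
  "(c \<odot>\<^bsub>grassmann_envelope A\<^esub> h) S = c \<odot> h S"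
  "\<zero>\<^bsub>grassmann_envelope A\<^esub> S = \<zero>"
  by (simp_all add: grassmann_envelope_def)

text \<open>
  A nonzero value at \<open>U\<close> needs a splitting of \<open>U\<close> into a set from the support of \<open>h\<close> and one from the
  support of \<open>g\<close>, so the support of the product is finite.
\<close>
lemma envelope_mult_closed:
  assumes h: "h \<in> carrier (grassmann_envelope A)" and g: "g \<in> carrier (grassmann_envelope A)"
  shows "h \<otimes>\<^bsub>grassmann_envelope A\<^esub> g \<in> carrier (grassmann_envelope A)"
  unfolding envelope_carrier_iff
proof (intro conjI allI)
  let ?hg = "h \<otimes>\<^bsub>grassmann_envelope A\<^esub> g"
  have "{U. ?hg U \<noteq> \<zero>} \<subseteq> (\<lambda>(S, T). S \<union> T) ` ({S. h S \<noteq> \<zero>} \<times> {T. g T \<noteq> \<zero>})"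
  proof
    fix U assume U: "U \<in> {U. ?hg U \<noteq> \<zero>}"
    then have fin: "finite U" using envelope_mult_infinite by blast
    have "\<exists>S\<in>Pow U. grassmann_sign S (U - S) \<odot> (h S \<otimes> g (U - S)) \<noteq> \<zero>"
    proof (rule ccontr)
      assume "\<not> ?thesis"
      then have "?hg U = (\<Oplus>S\<in>Pow U. \<zero>)"
        unfolding envelope_mult[OF fin] by (intro M.finsum_cong') auto
      then show False using U by simp
    qed
    then obtain S where S: "S \<subseteq> U" "grassmann_sign S (U - S) \<odot> (h S \<otimes> g (U - S)) \<noteq> \<zero>" by blast
    then have "h S \<noteq> \<zero>" "g (U - S) \<noteq> \<zero>" using h g by auto
    moreover have "U = S \<union> (U - S)" using S by blast
    ultimately show "U \<in> (\<lambda>(S, T). S \<union> T) ` ({S. h S \<noteq> \<zero>} \<times> {T. g T \<noteq> \<zero>})"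
      by (intro image_eqI[of _ _ "(S, U - S)"]) auto
  qed
  then show "finite {U. ?hg U \<noteq> \<zero>}"
    by (rule finite_subset) (use h g in \<open>auto simp: envelope_carrier_iff\<close>)
next
  fix U
  show "if finite U then (h \<otimes>\<^bsub>grassmann_envelope A\<^esub> g) U \<in> component A (of_nat (card U))
    else (h \<otimes>\<^bsub>grassmann_envelope A\<^esub> g) U = \<zero>"
  proof (cases "finite U")
    case True
    have "grassmann_sign S (U - S) \<odot> (h S \<otimes> g (U - S)) \<in> component A (of_nat (card U))"
      if S: "S \<in> Pow U" for S
    proof -
      have fin: "finite S" "finite (U - S)" using S True finite_subset by auto
      have "card U = card S + card (U - S)"
        using S True fin by (metis Diff_partition Diff_disjoint PowD card_Un_disjoint)
      then have "of_nat (card U) = (of_nat (card S) + of_nat (card (U - S)) :: bit)"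
        by (metis of_nat_add)
      moreover have "h S \<otimes> g (U - S) \<in> component A (of_nat (card S) + of_nat (card (U - S)))"
        using fin by (intro component_mult envelope_component h g)
      ultimately show ?thesis using component_smult by metis
    qed
    then show ?thesis
      using True submodule_finsum[OF component_submodule, of "Pow U"] by (simp add: envelope_mult)
  qed (simp add: envelope_mult_infinite)
qed

lemma envelope_nonassoc_algebra: "nonassoc_algebra (grassmann_envelope A)"
proof (rule nonassoc_algebraI)
  let ?E = "grassmann_envelope A"
  fix h g k :: "nat set \<Rightarrow> 'a" and c d :: 'k
  {
    assume h: "h \<in> carrier ?E" and g: "g \<in> carrier ?E"
    have "finite ({S. h S \<noteq> \<zero>} \<union> {S. g S \<noteq> \<zero>})"
      using h g by (simp add: envelope_carrier_iff)
    moreover have "{S. h S \<oplus> g S \<noteq> \<zero>} \<subseteq> {S. h S \<noteq> \<zero>} \<union> {S. g S \<noteq> \<zero>}" by auto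
    ultimately have "finite {S. h S \<oplus> g S \<noteq> \<zero>}" by (rule finite_subset[rotated])
    then show "h \<oplus>\<^bsub>?E\<^esub> g \<in> carrier ?E"
      using h g component_add by (simp add: envelope_carrier_iff)
    show "h \<oplus>\<^bsub>?E\<^esub> g = g \<oplus>\<^bsub>?E\<^esub> h"
      using h g by (simp add: fun_eq_iff M.a_comm)
    show "c \<odot>\<^bsub>?E\<^esub> (h \<oplus>\<^bsub>?E\<^esub> g) = c \<odot>\<^bsub>?E\<^esub> h \<oplus>\<^bsub>?E\<^esub> c \<odot>\<^bsub>?E\<^esub> g"
      using h g by (simp add: fun_eq_iff smult_add_right)
    show "h \<otimes>\<^bsub>?E\<^esub> g \<in> carrier ?E" using h g by (rule envelope_mult_closed)
    show "(c \<odot>\<^bsub>?E\<^esub> h) \<otimes>\<^bsub>?E\<^esub> g = c \<odot>\<^bsub>?E\<^esub> (h \<otimes>\<^bsub>?E\<^esub> g)"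
      "h \<otimes>\<^bsub>?E\<^esub> (c \<odot>\<^bsub>?E\<^esub> g) = c \<odot>\<^bsub>?E\<^esub> (h \<otimes>\<^bsub>?E\<^esub> g)"
    proof (rule_tac [!] ext)
      fix U
      have "c \<odot> (h \<otimes>\<^bsub>?E\<^esub> g) U =
          (\<Oplus>S\<in>Pow U. c \<odot> (grassmann_sign S (U - S) \<odot> (h S \<otimes> g (U - S))))" if fin: "finite U"
        unfolding envelope_mult[OF fin]
        by (rule finsum_smult_ldistr) (use fin h g mult_closed in auto)
      then show "((c \<odot>\<^bsub>?E\<^esub> h) \<otimes>\<^bsub>?E\<^esub> g) U = (c \<odot>\<^bsub>?E\<^esub> (h \<otimes>\<^bsub>?E\<^esub> g)) U"
        "(h \<otimes>\<^bsub>?E\<^esub> (c \<odot>\<^bsub>?E\<^esub> g)) U = (c \<odot>\<^bsub>?E\<^esub> (h \<otimes>\<^bsub>?E\<^esub> g)) U"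
        using h g by (cases "finite U"; simp add: envelope_mult envelope_mult_infinite mult_closed
          mult_smult_left mult_smult_right smult_smult mult.commute)+
    qed
  next
    assume h: "h \<in> carrier ?E" and g: "g \<in> carrier ?E" and k: "k \<in> carrier ?E"
    show "h \<oplus>\<^bsub>?E\<^esub> g \<oplus>\<^bsub>?E\<^esub> k = h \<oplus>\<^bsub>?E\<^esub> (g \<oplus>\<^bsub>?E\<^esub> k)"
      using h g k by (simp add: fun_eq_iff M.a_assoc)
    show "(h \<oplus>\<^bsub>?E\<^esub> g) \<otimes>\<^bsub>?E\<^esub> k = h \<otimes>\<^bsub>?E\<^esub> k \<oplus>\<^bsub>?E\<^esub> g \<otimes>\<^bsub>?E\<^esub> k"
    proof
      fix U
      show "((h \<oplus>\<^bsub>?E\<^esub> g) \<otimes>\<^bsub>?E\<^esub> k) U = (h \<otimes>\<^bsub>?E\<^esub> k \<oplus>\<^bsub>?E\<^esub> g \<otimes>\<^bsub>?E\<^esub> k) U"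
        using h g k by (cases "finite U")
          (simp_all add: envelope_mult envelope_mult_infinite mult_closed mult_add_left
            smult_add_right M.finsum_addf)
    qed
    show "k \<otimes>\<^bsub>?E\<^esub> (h \<oplus>\<^bsub>?E\<^esub> g) = k \<otimes>\<^bsub>?E\<^esub> h \<oplus>\<^bsub>?E\<^esub> k \<otimes>\<^bsub>?E\<^esub> g"
    proof
      fix U
      show "(k \<otimes>\<^bsub>?E\<^esub> (h \<oplus>\<^bsub>?E\<^esub> g)) U = (k \<otimes>\<^bsub>?E\<^esub> h \<oplus>\<^bsub>?E\<^esub> k \<otimes>\<^bsub>?E\<^esub> g) U"
        using h g k by (cases "finite U")
          (simp_all add: envelope_mult envelope_mult_infinite mult_closed mult_add_right
            smult_add_right M.finsum_addf)
    qed
  next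
    assume h: "h \<in> carrier ?E"
    show "\<zero>\<^bsub>?E\<^esub> \<oplus>\<^bsub>?E\<^esub> h = h" "1 \<odot>\<^bsub>?E\<^esub> h = h"
      "(c + d) \<odot>\<^bsub>?E\<^esub> h = c \<odot>\<^bsub>?E\<^esub> h \<oplus>\<^bsub>?E\<^esub> d \<odot>\<^bsub>?E\<^esub> h"
      "(c * d) \<odot>\<^bsub>?E\<^esub> h = c \<odot>\<^bsub>?E\<^esub> (d \<odot>\<^bsub>?E\<^esub> h)"
      using h by (simp_all add: fun_eq_iff smult_add_left smult_smult)
    have "finite {S. c \<odot> h S \<noteq> \<zero>}" for c
      by (rule finite_subset[of _ "{S. h S \<noteq> \<zero>}"]) (use h in \<open>auto simp: envelope_carrier_iff\<close>)
    then show "c \<odot>\<^bsub>?E\<^esub> h \<in> carrier ?E" for c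
      using h component_smult by (simp add: envelope_carrier_iff)
    then have "(- 1) \<odot>\<^bsub>?E\<^esub> h \<in> carrier ?E" .
    moreover have "(- 1) \<odot>\<^bsub>?E\<^esub> h \<oplus>\<^bsub>?E\<^esub> h = \<zero>\<^bsub>?E\<^esub>"
    proof
      fix S
      show "((- 1) \<odot>\<^bsub>?E\<^esub> h \<oplus>\<^bsub>?E\<^esub> h) S = \<zero>\<^bsub>?E\<^esub> S"
        using smult_add_left[of "h S" "- 1" 1] h by simp
    qed
    ultimately show "\<exists>g\<in>carrier ?E. g \<oplus>\<^bsub>?E\<^esub> h = \<zero>\<^bsub>?E\<^esub>" by blast
  }
  show "\<zero>\<^bsub>?E\<^esub> \<in> carrier ?E"
    using component_zero by (simp add: envelope_carrier_iff)
qed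

text \<open>
  Each value of a product in the envelope is a sum of multiples of products, and products annihilate each other.
\<close>
lemma envelope_metabelian:
  assumes "\<And>x y z t. x \<in> carrier A \<Longrightarrow> y \<in> carrier A \<Longrightarrow> z \<in> carrier A \<Longrightarrow> t \<in> carrier A \<Longrightarrow>
    (x \<otimes> y) \<otimes> (z \<otimes> t) = \<zero>"
  shows "satisfies (grassmann_envelope A) metabelian_poly"
proof -
  let ?E = "grassmann_envelope A"
  interpret E: nonassoc_algebra ?E by (rule envelope_nonassoc_algebra)
  have left: "(h \<otimes>\<^bsub>?E\<^esub> g) S \<otimes> (z \<otimes> t) = \<zero>"
    if "h \<in> carrier ?E" "g \<in> carrier ?E" "z \<in> carrier A" "t \<in> carrier A" for h g S z t
  proof (cases "finite S")
    case True
    then show ?thesis using that assms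
      by (simp add: envelope_mult finsum_mult_left mult_closed mult_smult_left)
  qed (use that in \<open>simp add: envelope_mult_infinite mult_closed\<close>)
  have both: "(h \<otimes>\<^bsub>?E\<^esub> g) S \<otimes> (k \<otimes>\<^bsub>?E\<^esub> l) T = \<zero>"
    if "h \<in> carrier ?E" "g \<in> carrier ?E" "k \<in> carrier ?E" "l \<in> carrier ?E" for h g k l S T
  proof (cases "finite T")
    case True
    then show ?thesis using that left
      by (simp add: envelope_mult[of T] finsum_mult_right mult_closed mult_smult_right
          envelope_mult_closed)
  qed (use that in \<open>simp add: envelope_mult_infinite mult_closed envelope_mult_closed\<close>)
  show ?thesis
    unfolding E.satisfies_metabelian_iff
  proof (intro ballI ext)
    fix h g k l U
    assume "h \<in> carrier ?E" "g \<in> carrier ?E" "k \<in> carrier ?E" "l \<in> carrier ?E"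
    then show "((h \<otimes>\<^bsub>?E\<^esub> g) \<otimes>\<^bsub>?E\<^esub> (k \<otimes>\<^bsub>?E\<^esub> l)) U = \<zero>\<^bsub>?E\<^esub> U"
      using both by (cases "finite U") (simp_all add: envelope_mult[of U] envelope_mult_infinite)
  qed
qed

text \<open>
  The element \<open>e\<^sub>S \<otimes> x\<close>, where \<open>e\<^sub>S\<close> is the basis element of the Grassmann algebra that belongs to \<open>S\<close>.
\<close>
definition tensor :: "nat set \<Rightarrow> 'a \<Rightarrow> nat set \<Rightarrow> 'a"
  where "tensor S x V = (if V = S then x else \<zero>)"

lemma tensor_closed:
  "finite S \<Longrightarrow> x \<in> component A (of_nat (card S)) \<Longrightarrow> tensor S x \<in> carrier (grassmann_envelope A)"
  by (auto simp: envelope_carrier_iff tensor_def component_zero)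

lemma tensor_mult:
  assumes fin: "finite S" "finite T" and disj: "S \<inter> T = {}" and x: "x \<in> carrier A" and y: "y \<in> carrier A"
  shows "tensor S x \<otimes>\<^bsub>grassmann_envelope A\<^esub> tensor T y =
    tensor (S \<union> T) (grassmann_sign S T \<odot> (x \<otimes> y))"
proof
  fix U
  show "(tensor S x \<otimes>\<^bsub>grassmann_envelope A\<^esub> tensor T y) U =
    tensor (S \<union> T) (grassmann_sign S T \<odot> (x \<otimes> y)) U"
  proof (cases "finite U")
    case True
    let ?f = "\<lambda>V. grassmann_sign V (U - V) \<odot> (tensor S x V \<otimes> tensor T y (U - V))"
    have UT: "V = S \<and> U - V = T \<longleftrightarrow> U = S \<union> T \<and> S = V" if "V \<in> Pow U" for V
      using that disj by auto
    have "(\<Oplus>V\<in>Pow U. ?f V) =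
        (\<Oplus>V\<in>Pow U. if S = V then tensor (S \<union> T) (grassmann_sign S T \<odot> (x \<otimes> y)) U else \<zero>)"
    proof (rule M.finsum_cong')
      fix V assume V: "V \<in> Pow U"
      show "?f V = (if S = V then tensor (S \<union> T) (grassmann_sign S T \<odot> (x \<otimes> y)) U else \<zero>)"
        using UT[OF V] x y by (auto simp: tensor_def)
    qed (use x y mult_closed in \<open>auto simp: tensor_def\<close>)
    also have "\<dots> = tensor (S \<union> T) (grassmann_sign S T \<odot> (x \<otimes> y)) U"
    proof (cases "S \<subseteq> U")
      case S: True
      show ?thesis
        by (rule M.finsum_singleton) (use True S x y mult_closed in \<open>auto simp: tensor_def\<close>)
    next
      case False
      then have "(\<Oplus>V\<in>Pow U. if S = V then tensor (S \<union> T) (grassmann_sign S T \<odot> (x \<otimes> y)) U else \<zero>)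
          = (\<Oplus>V\<in>Pow U. \<zero>)" by (intro M.finsum_cong') auto
      then show ?thesis using False by (auto simp: tensor_def)
    qed
    finally show ?thesis using True by (simp add: envelope_mult)
  next
    case False
    then show ?thesis using fin by (auto simp: envelope_mult_infinite tensor_def)
  qed
qed

text \<open>
  Multiply the four elements by Grassmann elements of the right parity with disjoint supports. Their product is
  a basis element up to sign, so the identity of the envelope returns to the superalgebra.
\<close>
lemma metabelian_of_envelope:
  assumes sat: "satisfies (grassmann_envelope A) metabelian_poly"
    and x: "x \<in> component A i" and y: "y \<in> component A j"
    and z: "z \<in> component A k" and t: "t \<in> component A l"
  shows "(x \<otimes> y) \<otimes> (z \<otimes> t) = \<zero>"
proof -
  let ?E = "grassmann_envelope A"
  interpret E: nonassoc_algebra ?E by (rule envelope_nonassoc_algebra)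
  define e where "e n i = (if i = (1::bit) then {n} else {})" for n :: nat and i
  have e: "finite (e n i)" "of_nat (card (e n i)) = i" for n i
    by (auto simp: e_def)
  have disj: "e 0 i \<inter> e 1 j = {}" "e 2 k \<inter> e 3 l = {}" "(e 0 i \<union> e 1 j) \<inter> (e 2 k \<union> e 3 l) = {}"
    by (auto simp: e_def)
  note c = component_closed[OF x] component_closed[OF y] component_closed[OF z] component_closed[OF t]
  have sign: "grassmann_sign S T \<noteq> (0::'k)" for S T
    by (simp add: grassmann_sign_def)
  have "tensor (e 0 i) x \<in> carrier ?E" "tensor (e 1 j) y \<in> carrier ?E"
    "tensor (e 2 k) z \<in> carrier ?E" "tensor (e 3 l) t \<in> carrier ?E"
    using x y z t by (auto intro!: tensor_closed simp: e)
  then have "(tensor (e 0 i) x \<otimes>\<^bsub>?E\<^esub> tensor (e 1 j) y) \<otimes>\<^bsub>?E\<^esub>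
      (tensor (e 2 k) z \<otimes>\<^bsub>?E\<^esub> tensor (e 3 l) t) = \<zero>\<^bsub>?E\<^esub>"
    using sat unfolding E.satisfies_metabelian_iff by blast
  then have "tensor ((e 0 i \<union> e 1 j) \<union> (e 2 k \<union> e 3 l))
      (grassmann_sign (e 0 i \<union> e 1 j) (e 2 k \<union> e 3 l) \<odot>
        ((grassmann_sign (e 0 i) (e 1 j) \<odot> (x \<otimes> y)) \<otimes> (grassmann_sign (e 2 k) (e 3 l) \<odot> (z \<otimes> t))))
      = \<zero>\<^bsub>?E\<^esub>"
    using c e disj by (simp add: tensor_mult mult_closed)
  from fun_cong[OF this, of "(e 0 i \<union> e 1 j) \<union> (e 2 k \<union> e 3 l)"]
  have "(grassmann_sign (e 0 i \<union> e 1 j) (e 2 k \<union> e 3 l) *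
      (grassmann_sign (e 0 i) (e 1 j) * grassmann_sign (e 2 k) (e 3 l))) \<odot> ((x \<otimes> y) \<otimes> (z \<otimes> t)) = \<zero>"
    (is "?c \<odot> _ = \<zero>")
    using c by (simp add: tensor_def mult_closed mult_smult_left mult_smult_right smult_smult mult_ac)
  then have "inverse ?c \<odot> (?c \<odot> ((x \<otimes> y) \<otimes> (z \<otimes> t))) = \<zero>" by simp
  moreover have "?c \<noteq> 0" by (simp add: sign)
  then have "inverse ?c * ?c = 1" by (rule left_inverse)
  moreover have "(x \<otimes> y) \<otimes> (z \<otimes> t) \<in> carrier A" using c mult_closed by simp
  ultimately show ?thesis by (simp only: smult_smult smult_1)
qed

end

section \<open>Absolutely free superalgebras\<close>

lemma lookup_scale [simp]:
  "Poly_Mapping.lookup (Poly_Mapping.map ((*) c) p) w = (c :: 'k::field) * Poly_Mapping.lookup p w"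
  by (simp add: Poly_Mapping.map.rep_eq when_def)

lemma keys_scale: "Poly_Mapping.keys (Poly_Mapping.map ((*) (c :: 'k::field)) p) \<subseteq> Poly_Mapping.keys p"
  by (auto simp: in_keys_iff)

lemma lookup_free_mult [simp]:
  "Poly_Mapping.lookup (p \<otimes>\<^bsub>free_superalgebra r s\<^esub> q) (Gen x) = 0"
  "Poly_Mapping.lookup (p \<otimes>\<^bsub>free_superalgebra r s\<^esub> q) (Prod u v) =
    Poly_Mapping.lookup p u * Poly_Mapping.lookup q v"
proof -
  show "Poly_Mapping.lookup (p \<otimes>\<^bsub>free_superalgebra r s\<^esub> q) (Gen x) = 0"
    by (simp add: free_superalgebra_def lookup_sum lookup_single)
  have "Poly_Mapping.lookup (p \<otimes>\<^bsub>free_superalgebra r s\<^esub> q) (Prod u v) =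
      (\<Sum>u' \<in> Poly_Mapping.keys p. \<Sum>v' \<in> Poly_Mapping.keys q.
        if u' = u then if v' = v then Poly_Mapping.lookup p u' * Poly_Mapping.lookup q v' else 0 else 0)"
    by (auto simp: free_superalgebra_def lookup_sum lookup_single when_def intro!: sum.cong)
  also have "\<dots> = (\<Sum>u' \<in> Poly_Mapping.keys p. if u' = u then
      (\<Sum>v' \<in> Poly_Mapping.keys q. if v' = v then Poly_Mapping.lookup p u' * Poly_Mapping.lookup q v' else 0)
      else 0)"
    by (intro sum.cong) auto
  also have "\<dots> = Poly_Mapping.lookup p u * Poly_Mapping.lookup q v"
    by (auto simp: in_keys_iff)
  finally show "Poly_Mapping.lookup (p \<otimes>\<^bsub>free_superalgebra r s\<^esub> q) (Prod u v) =
    Poly_Mapping.lookup p u * Poly_Mapping.lookup q v" .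
qed

lemma keys_free_mult:
  "w \<in> Poly_Mapping.keys (p \<otimes>\<^bsub>free_superalgebra r s\<^esub> q) \<longleftrightarrow>
    (\<exists>u v. w = Prod u v \<and> u \<in> Poly_Mapping.keys p \<and> v \<in> Poly_Mapping.keys q)"
  by (cases w) (simp_all add: in_keys_iff)

lemma free_superalgebra_simps [simp]:
  "carrier (free_superalgebra r s) = free_carrier r s"
  "\<zero>\<^bsub>free_superalgebra r s\<^esub> = 0"
  "p \<oplus>\<^bsub>free_superalgebra r s\<^esub> q = p + q"
  "c \<odot>\<^bsub>free_superalgebra r s\<^esub> p = Poly_Mapping.map ((*) c) p"
  by (simp_all add: free_superalgebra_def)

lemma free_component_iff:
  "p \<in> component (free_superalgebra r s) i \<longleftrightarrow>
    p \<in> free_carrier r s \<and> (\<forall>w \<in> Poly_Mapping.keys p. parity w = i)"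
  by (simp add: free_superalgebra_def)

lemma free_carrier_iff:
  "p \<in> free_carrier r s \<longleftrightarrow>
    (\<forall>w. Poly_Mapping.lookup p w \<noteq> 0 \<longrightarrow> set (letters w) \<subseteq> Inl ` {..<r} \<union> Inr ` {..<s})"
  by (auto simp: free_carrier_def in_keys_iff)

text \<open>
  The part of a polynomial supported on the words with property \<open>Q\<close>; it provides homogeneous components.
\<close>
definition restriction :: "('x word \<Rightarrow> bool) \<Rightarrow> ('k::field, 'x) nonassoc_poly \<Rightarrow> ('k, 'x) nonassoc_poly"
  where "restriction Q p =
    (\<Sum>w \<in> {w \<in> Poly_Mapping.keys p. Q w}. Poly_Mapping.single w (Poly_Mapping.lookup p w))"

lemma lookup_restriction [simp]:
  "Poly_Mapping.lookup (restriction Q p) w = (if Q w then Poly_Mapping.lookup p w else 0)"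
  by (auto simp: restriction_def lookup_sum lookup_single when_def in_keys_iff)

lemma free_nonassoc_algebra:
  "nonassoc_algebra (free_superalgebra r s :: ('k::field, ('k, nat + nat) nonassoc_poly) superalgebra)"
proof (rule nonassoc_algebraI)
  let ?F = "free_superalgebra r s :: ('k, ('k, nat + nat) nonassoc_poly) superalgebra"
  fix p q t :: "('k, nat + nat) nonassoc_poly" and c d :: 'k
  show "(p \<oplus>\<^bsub>?F\<^esub> q) \<otimes>\<^bsub>?F\<^esub> t = p \<otimes>\<^bsub>?F\<^esub> t \<oplus>\<^bsub>?F\<^esub> q \<otimes>\<^bsub>?F\<^esub> t"
    "t \<otimes>\<^bsub>?F\<^esub> (p \<oplus>\<^bsub>?F\<^esub> q) = t \<otimes>\<^bsub>?F\<^esub> p \<oplus>\<^bsub>?F\<^esub> t \<otimes>\<^bsub>?F\<^esub> q"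
    "(c \<odot>\<^bsub>?F\<^esub> p) \<otimes>\<^bsub>?F\<^esub> q = c \<odot>\<^bsub>?F\<^esub> (p \<otimes>\<^bsub>?F\<^esub> q)"
    "p \<otimes>\<^bsub>?F\<^esub> (c \<odot>\<^bsub>?F\<^esub> q) = c \<odot>\<^bsub>?F\<^esub> (p \<otimes>\<^bsub>?F\<^esub> q)"
    "(c + d) \<odot>\<^bsub>?F\<^esub> p = c \<odot>\<^bsub>?F\<^esub> p \<oplus>\<^bsub>?F\<^esub> d \<odot>\<^bsub>?F\<^esub> p"
    "c \<odot>\<^bsub>?F\<^esub> (p \<oplus>\<^bsub>?F\<^esub> q) = c \<odot>\<^bsub>?F\<^esub> p \<oplus>\<^bsub>?F\<^esub> c \<odot>\<^bsub>?F\<^esub> q"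
    "(c * d) \<odot>\<^bsub>?F\<^esub> p = c \<odot>\<^bsub>?F\<^esub> (d \<odot>\<^bsub>?F\<^esub> p)"
    "1 \<odot>\<^bsub>?F\<^esub> p = p"
         apply (rule_tac [!] poly_mapping_eqI)
         apply (rename_tac [!] w)
         apply (case_tac w; simp add: lookup_add algebra_simps)
        apply (case_tac w; simp add: lookup_add algebra_simps)
       apply (case_tac w; simp add: lookup_add algebra_simps)
      apply (case_tac w; simp add: lookup_add algebra_simps)
    by (simp_all add: lookup_add algebra_simps)
  {
    assume p: "p \<in> carrier ?F"
    show "c \<odot>\<^bsub>?F\<^esub> p \<in> carrier ?F" using p by (simp add: free_carrier_iff)
    have "- p \<in> carrier ?F" "- p \<oplus>\<^bsub>?F\<^esub> p = \<zero>\<^bsub>?F\<^esub>"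
      using p by (simp_all add: free_carrier_iff)
    then show "\<exists>q\<in>carrier ?F. q \<oplus>\<^bsub>?F\<^esub> p = \<zero>\<^bsub>?F\<^esub>" by blast
    assume q: "q \<in> carrier ?F"
    show "p \<oplus>\<^bsub>?F\<^esub> q \<in> carrier ?F"
      using p q keys_add[of p q] unfolding free_superalgebra_simps free_carrier_def mem_Collect_eq
      by (meson UnE subsetD)
    show "p \<otimes>\<^bsub>?F\<^esub> q \<in> carrier ?F"
      unfolding free_superalgebra_simps free_carrier_def mem_Collect_eq
    proof
      fix w assume "w \<in> Poly_Mapping.keys (p \<otimes>\<^bsub>?F\<^esub> q)"
      then obtain u v where w: "w = Prod u v" and "u \<in> Poly_Mapping.keys p" "v \<in> Poly_Mapping.keys q"
        unfolding keys_free_mult by blast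
      then have "set (letters u) \<subseteq> Inl ` {..<r} \<union> Inr ` {..<s}"
        "set (letters v) \<subseteq> Inl ` {..<r} \<union> Inr ` {..<s}"
        using p q unfolding free_superalgebra_simps free_carrier_def mem_Collect_eq by blast+
      then show "set (letters w) \<subseteq> Inl ` {..<r} \<union> Inr ` {..<s}"
        unfolding w letters.simps set_append by (rule Un_least)
    qed
  }
qed (auto simp: free_carrier_iff add_ac)

lemma free_superalgebra:
  "superalgebra (free_superalgebra r s :: ('k::field, ('k, nat + nat) nonassoc_poly) superalgebra)"
proof -
  let ?F = "free_superalgebra r s :: ('k, ('k, nat + nat) nonassoc_poly) superalgebra"
  interpret F: nonassoc_algebra ?F by (rule free_nonassoc_algebra)
  show ?thesis
  proof (intro superalgebra.intro superalgebra_axioms.intro)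
    show "nonassoc_algebra ?F" by (rule free_nonassoc_algebra)
    show "submodule (component ?F i) scalars ?F" for i
    proof (rule F.subspaceI)
      fix p q :: "('k, nat + nat) nonassoc_poly"
      assume pq: "p \<in> component ?F i" "q \<in> component ?F i"
      then have "p \<oplus>\<^bsub>?F\<^esub> q \<in> carrier ?F"
        by (intro F.M.a_closed) (auto simp: free_component_iff)
      then show "p \<oplus>\<^bsub>?F\<^esub> q \<in> component ?F i"
        using pq keys_add[of p q] by (auto simp: free_component_iff)
    next
      fix p :: "('k, nat + nat) nonassoc_poly" and c :: 'k
      assume p: "p \<in> component ?F i"
      then have "c \<odot>\<^bsub>?F\<^esub> p \<in> carrier ?F"
        by (intro F.smult_carrier) (auto simp: free_component_iff)
      then show "c \<odot>\<^bsub>?F\<^esub> p \<in> component ?F i"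
        using p keys_scale[of c p] by (auto simp: free_component_iff)
    qed (auto simp: free_component_iff, simp add: free_carrier_iff)
    show "component ?F 0 <+>\<^bsub>?F\<^esub> component ?F 1 = carrier ?F"
    proof
      show "component ?F 0 <+>\<^bsub>?F\<^esub> component ?F 1 \<subseteq> carrier ?F"
        using F.M.a_closed by (auto simp: set_add_def' free_component_iff)
      show "carrier ?F \<subseteq> component ?F 0 <+>\<^bsub>?F\<^esub> component ?F 1"
      proof
        fix p assume p: "p \<in> carrier ?F"
        let ?q = "\<lambda>i. restriction (\<lambda>w. parity w = i) p"
        have "?q i \<in> component ?F i" for i
          using p by (auto simp: free_component_iff free_carrier_iff in_keys_iff split: if_splits)
        moreover have "p = ?q 0 \<oplus>\<^bsub>?F\<^esub> ?q 1"
          by (auto intro!: poly_mapping_eqI simp: lookup_add)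
        ultimately show "p \<in> component ?F 0 <+>\<^bsub>?F\<^esub> component ?F 1"
          unfolding set_add_def' by blast
      qed
    qed
    show "component ?F 0 \<inter> component ?F 1 = {\<zero>\<^bsub>?F\<^esub>}"
    proof -
      have "p = 0" if "p \<in> component ?F 0" "p \<in> component ?F 1" for p
        using that by (intro poly_mapping_eqI) (auto simp: free_component_iff in_keys_iff)
      moreover have "0 \<in> component ?F i" for i
        by (simp add: free_component_iff free_carrier_iff)
      ultimately show ?thesis by auto
    qed
    fix p q i j assume pq: "p \<in> component ?F i" "q \<in> component ?F j"
    then have "p \<otimes>\<^bsub>?F\<^esub> q \<in> carrier ?F"
      by (intro F.mult_closed) (auto simp: free_component_iff)
    then show "p \<otimes>\<^bsub>?F\<^esub> q \<in> component ?F (i + j)"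
      using pq by (auto simp: free_component_iff keys_free_mult simp del: add_bit_eq_xor)
  qed
qed

lemma free_finsum:
  fixes f :: "'i \<Rightarrow> ('k::field, nat + nat) nonassoc_poly"
  assumes "finite S" "\<And>i. i \<in> S \<Longrightarrow> f i \<in> free_carrier r s"
  shows "(\<Oplus>\<^bsub>free_superalgebra r s\<^esub>i\<in>S. f i) = (\<Sum>i\<in>S. f i)"
proof -
  interpret F: nonassoc_algebra "free_superalgebra r s :: ('k, ('k, nat + nat) nonassoc_poly) superalgebra"
    by (rule free_nonassoc_algebra)
  show ?thesis using assms
  proof (induction S rule: finite_induct)
    case (insert i S)
    then have "f \<in> S \<rightarrow> carrier (free_superalgebra r s)" "f i \<in> carrier (free_superalgebra r s)" by auto
    then show ?case using insert by simp
  qed simp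
qed

section \<open>The free metabelian superalgebras\<close>

primrec composite :: "'x word \<Rightarrow> bool"
  where
    "composite (Gen x) \<longleftrightarrow> False"
  | "composite (Prod u v) \<longleftrightarrow> True"

text \<open>
  These words have a factor \<open>(u v) (w z)\<close>, hence vanish in every metabelian algebra; the other words form a
  basis of the free metabelian superalgebra.
\<close>
primrec metabelian_null :: "'x word \<Rightarrow> bool"
  where
    "metabelian_null (Gen x) \<longleftrightarrow> False"
  | "metabelian_null (Prod u v) \<longleftrightarrow>
      metabelian_null u \<or> metabelian_null v \<or> composite u \<and> composite v"

definition metabelian_ideal :: "nat \<Rightarrow> nat \<Rightarrow> ('k::field, nat + nat) nonassoc_poly set"
  where "metabelian_ideal r s =
    {p \<in> free_carrier r s. \<forall>w \<in> Poly_Mapping.keys p. metabelian_null w}"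

lemma metabelian_ideal_graded:
  "graded_ideal (metabelian_ideal r s)
    (free_superalgebra r s :: ('k::field, ('k, nat + nat) nonassoc_poly) superalgebra)"
proof -
  let ?F = "free_superalgebra r s :: ('k, ('k, nat + nat) nonassoc_poly) superalgebra"
  interpret F: superalgebra ?F by (rule free_superalgebra)
  have sub: "submodule (metabelian_ideal r s) scalars ?F"
  proof (rule F.subspaceI)
    fix p q :: "('k, nat + nat) nonassoc_poly"
    assume pq: "p \<in> metabelian_ideal r s" "q \<in> metabelian_ideal r s"
    then have "p \<oplus>\<^bsub>?F\<^esub> q \<in> carrier ?F"
      by (intro F.M.a_closed) (auto simp: metabelian_ideal_def)
    then show "p \<oplus>\<^bsub>?F\<^esub> q \<in> metabelian_ideal r s"
      using pq keys_add[of p q] by (auto simp: metabelian_ideal_def)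
  next
    fix p :: "('k, nat + nat) nonassoc_poly" and c :: 'k
    assume p: "p \<in> metabelian_ideal r s"
    then have "c \<odot>\<^bsub>?F\<^esub> p \<in> carrier ?F"
      by (intro F.smult_carrier) (auto simp: metabelian_ideal_def)
    then show "c \<odot>\<^bsub>?F\<^esub> p \<in> metabelian_ideal r s"
      using p keys_scale[of c p] by (auto simp: metabelian_ideal_def)
  qed (auto simp: metabelian_ideal_def, simp add: free_carrier_iff)
  show ?thesis
  proof (intro graded_ideal.intro graded_ideal_axioms.intro sub)
    show "superalgebra ?F" by (rule free_superalgebra)
    fix p q :: "('k, nat + nat) nonassoc_poly"
    assume p: "p \<in> carrier ?F" and q: "q \<in> metabelian_ideal r s"
    then have "p \<otimes>\<^bsub>?F\<^esub> q \<in> carrier ?F" "q \<otimes>\<^bsub>?F\<^esub> p \<in> carrier ?F"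
      by (auto intro!: F.mult_closed simp: metabelian_ideal_def simp del: free_superalgebra_simps)
        (auto simp: metabelian_ideal_def)
    then show "p \<otimes>\<^bsub>?F\<^esub> q \<in> metabelian_ideal r s" "q \<otimes>\<^bsub>?F\<^esub> p \<in> metabelian_ideal r s"
      using q by (auto simp: metabelian_ideal_def keys_free_mult)
  next
    let ?I = "metabelian_ideal r s :: ('k, nat + nat) nonassoc_poly set"
    show "(?I \<inter> component ?F 0) <+>\<^bsub>?F\<^esub> (?I \<inter> component ?F 1) = ?I"
    proof
      show "(?I \<inter> component ?F 0) <+>\<^bsub>?F\<^esub> (?I \<inter> component ?F 1) \<subseteq> ?I"
        using F.submoduleD(3)[OF sub] by (auto simp: set_add_def')
      show "?I \<subseteq> (?I \<inter> component ?F 0) <+>\<^bsub>?F\<^esub> (?I \<inter> component ?F 1)"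
      proof
        fix p assume p: "p \<in> ?I"
        let ?q = "\<lambda>i. restriction (\<lambda>w. parity w = i) p"
        have "?q i \<in> ?I \<inter> component ?F i" for i
          using p by (auto simp: metabelian_ideal_def free_component_iff free_carrier_iff in_keys_iff
              split: if_splits)
        moreover have "p = ?q 0 \<oplus>\<^bsub>?F\<^esub> ?q 1"
          by (auto intro!: poly_mapping_eqI simp: lookup_add)
        ultimately show "p \<in> (?I \<inter> component ?F 0) <+>\<^bsub>?F\<^esub> (?I \<inter> component ?F 1)"
          unfolding set_add_def' by blast
      qed
    qed
  qed
qed

text \<open>
  A word of the form \<open>(u v) (w z)\<close> lies in the ideal, so products annihilate each other in the quotient,
  and this suffices for its envelope to be metabelian.
\<close>
lemma metabelian_quotient:
  "variety_superalgebra {metabelian_poly}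
    (quotient_superalgebra (free_superalgebra r s) (metabelian_ideal r s ::
      ('k::field, nat + nat) nonassoc_poly set))"
proof -
  let ?F = "free_superalgebra r s :: ('k, ('k, nat + nat) nonassoc_poly) superalgebra"
  let ?I = "metabelian_ideal r s :: ('k, nat + nat) nonassoc_poly set"
  let ?Q = "quotient_superalgebra ?F ?I"
  interpret I: graded_ideal ?I ?F by (rule metabelian_ideal_graded)
  interpret E: superalgebra_epimorphism ?F ?Q "\<lambda>x. ?I +>\<^bsub>?F\<^esub> x" by (rule I.quotient_epimorphism)
  interpret Q: superalgebra ?Q by (rule E.image_superalgebra)
  have "(x \<otimes>\<^bsub>?Q\<^esub> y) \<otimes>\<^bsub>?Q\<^esub> (z \<otimes>\<^bsub>?Q\<^esub> t) = \<zero>\<^bsub>?Q\<^esub>"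
    if xyzt: "x \<in> carrier ?Q" "y \<in> carrier ?Q" "z \<in> carrier ?Q" "t \<in> carrier ?Q" for x y z t
  proof -
    obtain a b c d where abcd: "a \<in> carrier ?F" "b \<in> carrier ?F" "c \<in> carrier ?F" "d \<in> carrier ?F"
      and eq: "x = ?I +>\<^bsub>?F\<^esub> a" "y = ?I +>\<^bsub>?F\<^esub> b" "z = ?I +>\<^bsub>?F\<^esub> c" "t = ?I +>\<^bsub>?F\<^esub> d"
      using xyzt unfolding E.carrier_image by blast
    let ?p = "(a \<otimes>\<^bsub>?F\<^esub> b) \<otimes>\<^bsub>?F\<^esub> (c \<otimes>\<^bsub>?F\<^esub> d)"
    have closed: "?p \<in> carrier ?F" using abcd by (intro I.mult_closed)
    then have "?p \<in> ?I"
      by (auto simp: metabelian_ideal_def keys_free_mult)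
    then have "?I +>\<^bsub>?F\<^esub> ?p = \<zero>\<^bsub>?Q\<^esub>"
      using I.coset_eq_zero_iff[OF closed] by (simp add: quotient_superalgebra_def)
    then show ?thesis
      unfolding eq using abcd by (simp only: E.hom_mult I.mult_closed)
  qed
  then have "satisfies (grassmann_envelope ?Q) metabelian_poly"
    by (rule Q.envelope_metabelian)
  then show ?thesis
    using Q.envelope_nonassoc_algebra Q.superalgebra_axioms
    by (simp add: variety_superalgebra_def variety_def)
qed

text \<open>
  By induction on the word: words are homogeneous, so \<open>metabelian_of_envelope\<close> applies to a factor
  \<open>(u v) (w z)\<close>, and an ideal absorbs the rest of the word.
\<close>
lemma metabelian_ideal_minimal:
  fixes I :: "('k::field, nat + nat) nonassoc_poly set"
  assumes I: "graded_ideal I (free_superalgebra r s)"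
    and Q: "variety_superalgebra {metabelian_poly} (quotient_superalgebra (free_superalgebra r s) I)"
  shows "metabelian_ideal r s \<subseteq> I"
proof -
  let ?F = "free_superalgebra r s :: ('k, ('k, nat + nat) nonassoc_poly) superalgebra"
  let ?Q = "quotient_superalgebra ?F I"
  interpret I: graded_ideal I ?F by (rule I)
  interpret E: superalgebra_epimorphism ?F ?Q "\<lambda>x. I +>\<^bsub>?F\<^esub> x" by (rule I.quotient_epimorphism)
  interpret Q: superalgebra ?Q by (rule E.image_superalgebra)
  have sat: "satisfies (grassmann_envelope ?Q) metabelian_poly"
    using Q by (simp add: variety_superalgebra_def variety_def)
  define V where "V = (Inl ` {..<r} \<union> Inr ` {..<s} :: (nat + nat) set)"
  let ?b = "\<lambda>w. Poly_Mapping.single w 1 :: ('k, nat + nat) nonassoc_poly"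
  have comp: "?b w \<in> component ?F (parity w)" if "set (letters w) \<subseteq> V" for w
    using that by (auto simp: free_component_iff free_carrier_def V_def)
  have closed: "?b w \<in> carrier ?F" if "set (letters w) \<subseteq> V" for w
    using that I.component_closed[OF comp] by simp
  have prod: "?b (Prod u v) = ?b u \<otimes>\<^bsub>?F\<^esub> ?b v" for u v
  proof (rule poly_mapping_eqI)
    fix w show "Poly_Mapping.lookup (?b (Prod u v)) w = Poly_Mapping.lookup (?b u \<otimes>\<^bsub>?F\<^esub> ?b v) w"
      by (cases w) (auto simp: lookup_single when_def)
  qed
  have word: "?b w \<in> I" if "metabelian_null w" "set (letters w) \<subseteq> V" for w
    using that
  proof (induction w)
    case (Prod u v)
    have uv: "set (letters u) \<subseteq> V" "set (letters v) \<subseteq> V" using Prod.prems by auto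
    consider "metabelian_null u" | "metabelian_null v" | "composite u" "composite v"
      using Prod.prems by auto
    then show ?case
    proof cases
      case 1
      then show ?thesis unfolding prod using uv Prod.IH closed by (intro I.ideal_right) auto
    next
      case 2
      then show ?thesis unfolding prod using uv Prod.IH closed by (intro I.ideal_left) auto
    next
      case 3
      then obtain a b c d where eq: "u = Prod a b" "v = Prod c d" by (cases u; cases v) auto
      then have lets: "set (letters a) \<subseteq> V" "set (letters b) \<subseteq> V" "set (letters c) \<subseteq> V"
        "set (letters d) \<subseteq> V" using uv by auto
      have Qcomp: "I +>\<^bsub>?F\<^esub> ?b w \<in> component ?Q (parity w)" if "set (letters w) \<subseteq> V" for w
        unfolding E.component_image using comp[OF that] by (rule imageI)
      have "I +>\<^bsub>?F\<^esub> ?b (Prod u v) = \<zero>\<^bsub>?Q\<^esub>"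
        using Q.metabelian_of_envelope[OF sat Qcomp Qcomp Qcomp Qcomp] lets
        unfolding eq prod by (simp only: E.hom_mult I.mult_closed closed)
      then show ?thesis
        using I.coset_eq_zero_iff[OF closed] Prod.prems by (simp add: quotient_superalgebra_def)
    qed
  qed simp
  show ?thesis
  proof
    fix p :: "('k, nat + nat) nonassoc_poly" assume p: "p \<in> metabelian_ideal r s"
    let ?f = "\<lambda>w. Poly_Mapping.lookup p w \<odot>\<^bsub>?F\<^esub> ?b w"
    have lets: "set (letters w) \<subseteq> V" if "w \<in> Poly_Mapping.keys p" for w
      using p that by (auto simp: metabelian_ideal_def free_carrier_def V_def)
    have "?f w \<in> I" if "w \<in> Poly_Mapping.keys p" for w
      using p that by (intro I.submoduleD(4)[OF I.submodule_axioms] word lets)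
        (simp add: metabelian_ideal_def)
    then have "(\<Oplus>\<^bsub>?F\<^esub>w\<in>Poly_Mapping.keys p. ?f w) \<in> I"
      by (intro I.submodule_finsum I.submodule_axioms) auto
    moreover have "?f w \<in> free_carrier r s" if "w \<in> Poly_Mapping.keys p" for w
      using I.smult_carrier[OF closed[OF lets[OF that]]] by simp
    then have "(\<Oplus>\<^bsub>?F\<^esub>w\<in>Poly_Mapping.keys p. ?f w) = (\<Sum>w\<in>Poly_Mapping.keys p. ?f w)"
      by (intro free_finsum) auto
    moreover have "(\<Sum>w\<in>Poly_Mapping.keys p. Poly_Mapping.single w (Poly_Mapping.lookup p w)) = p"
      by (rule poly_mapping_eqI) (auto simp: lookup_sum lookup_single when_def in_keys_iff)
    ultimately show "p \<in> I" by simp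
  qed
qed

proposition free_metabelian_superalgebra_eq:
  "free_variety_superalgebra {metabelian_poly :: ('k::field, nat) nonassoc_poly} r s =
    quotient_superalgebra (free_superalgebra r s) (metabelian_ideal r s)"
proof -
  have "\<Inter> {I. graded_ideal I (free_superalgebra r s) \<and>
      variety_superalgebra {metabelian_poly :: ('k, nat) nonassoc_poly}
        (quotient_superalgebra (free_superalgebra r s) I)} = metabelian_ideal r s"
    by (rule antisym)
      (use metabelian_ideal_graded metabelian_quotient metabelian_ideal_minimal in blast)+
  then show ?thesis by (simp add: free_variety_superalgebra_def)
qed

lemma free_metabelian_super_satisfies_iff:
  fixes f :: "('k::field, nat) nonassoc_poly"
  shows "super_satisfies (free_variety_superalgebra {metabelian_poly} r s) f \<longleftrightarrow>
    (\<forall>p a. (\<forall>v. a v \<in> component (free_superalgebra r s) (p v)) \<longrightarrow>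
      super_eval (free_superalgebra r s) p a f \<in> metabelian_ideal r s)"
proof -
  let ?F = "free_superalgebra r s :: ('k, ('k, nat + nat) nonassoc_poly) superalgebra"
  let ?I = "metabelian_ideal r s :: ('k, nat + nat) nonassoc_poly set"
  let ?Q = "quotient_superalgebra ?F ?I"
  interpret I: graded_ideal ?I ?F by (rule metabelian_ideal_graded)
  interpret E: superalgebra_epimorphism ?F ?Q "\<lambda>x. ?I +>\<^bsub>?F\<^esub> x" by (rule I.quotient_epimorphism)
  have "super_eval ?F p a f \<in> carrier ?F" if "\<forall>v. a v \<in> component ?F (p v)" for p a
    by (rule super_eval_closed[OF I.nonassoc_algebra_axioms]) (use that I.component_closed in blast)
  then show ?thesis
    unfolding free_metabelian_superalgebra_eq E.super_satisfies_image_iff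
    using I.coset_eq_zero_iff by (simp add: quotient_superalgebra_def)
qed

text \<open>
  The free superalgebra of rank \<open>(r', s')\<close> has an isomorphic copy \<open>A\<close> on the universe. It satisfies the same
  superidentities, so it belongs to the first supervariety, hence to the second, whose superidentities it
  therefore satisfies. The zero superalgebra, which forms the supervariety of rank \<open>(0, 0)\<close>, satisfies
  every polynomial.
\<close>
lemma super_satisfies_of_supervariety_subset:
  fixes \<iota> :: "('k::field_char_0, nat + nat) nonassoc_poly \<Rightarrow> 'u"
    and f :: "('k, nat) nonassoc_poly"
  assumes inj: "inj \<iota>" and nonzero: "(r', s') \<noteq> (0, 0)"
    and sub: "(metabelian_supervariety r' s' :: ('k, 'u) superalgebra set) \<subseteq> metabelian_supervariety r s"
    and f: "multilinear f" "super_satisfies (free_variety_superalgebra {metabelian_poly} r s) f"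
  shows "super_satisfies (free_variety_superalgebra {metabelian_poly} r' s') f"
proof -
  let ?F = "free_superalgebra r' s' :: ('k, ('k, nat + nat) nonassoc_poly) superalgebra"
  let ?I = "metabelian_ideal r' s' :: ('k, nat + nat) nonassoc_poly set"
  let ?Q = "quotient_superalgebra ?F ?I"
  interpret I: graded_ideal ?I ?F by (rule metabelian_ideal_graded)
  interpret E: superalgebra_epimorphism ?F ?Q "\<lambda>x. ?I +>\<^bsub>?F\<^esub> x" by (rule I.quotient_epimorphism)
  interpret Q: superalgebra ?Q by (rule E.image_superalgebra)
  define g where "g = \<iota> \<circ> (\<lambda>C. SOME x. x \<in> C)"
  have g: "inj_on g (carrier ?Q)"
    unfolding g_def by (rule comp_inj_on[OF I.inj_on_representative inj_on_subset[OF inj subset_UNIV]])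
  then obtain A :: "('k, 'u) superalgebra" where "superalgebra_epimorphism ?Q A g"
    by (rule Q.embedding_into_type)
  then interpret A: superalgebra_epimorphism ?Q A g by simp
  interpret A': superalgebra A by (rule A.image_superalgebra)
  have iff: "super_satisfies A h \<longleftrightarrow> super_satisfies ?Q h" for h
  proof -
    have "g x = \<zero>\<^bsub>A\<^esub> \<longleftrightarrow> x = \<zero>\<^bsub>?Q\<^esub>" if "x \<in> carrier ?Q" for x
      using inj_on_eq_iff[OF g that Q.M.zero_closed] by (simp only: A.hom_zero)
    moreover have "super_eval ?Q p a h \<in> carrier ?Q" if "\<forall>v. a v \<in> component ?Q (p v)" for p a
      by (rule super_eval_closed[OF Q.nonassoc_algebra_axioms]) (use that Q.component_closed in blast)
    ultimately show ?thesis
      unfolding A.super_satisfies_image_iff by (simp add: super_satisfies_def)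
  qed
  have "A \<in> metabelian_supervariety r' s'"
    using nonzero iff A'.superalgebra_axioms
    by (auto simp: metabelian_supervariety_def rank_supervariety_def generated_supervariety_def
        free_metabelian_superalgebra_eq)
  then have A: "A \<in> metabelian_supervariety r s" using sub by blast
  have "super_satisfies A f"
  proof (cases "r = 0 \<and> s = 0")
    case True
    then have zero: "carrier A = {\<zero>\<^bsub>A\<^esub>}"
      using A by (simp add: metabelian_supervariety_def rank_supervariety_def)
    show ?thesis
      unfolding super_satisfies_def
    proof (intro allI impI)
      fix p :: "nat \<Rightarrow> bit" and a assume "\<forall>v. a v \<in> component A (p v)"
      then have "super_eval A p a f \<in> carrier A"
        by (intro super_eval_closed A'.nonassoc_algebra_axioms) (use A'.component_closed in blast)
      then show "super_eval A p a f = \<zero>\<^bsub>A\<^esub>" using zero by simp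
    qed
  next
    case False
    then show ?thesis
      using A f by (auto simp: metabelian_supervariety_def rank_supervariety_def generated_supervariety_def)
  qed
  then show ?thesis unfolding iff free_metabelian_superalgebra_eq .
qed

section \<open>Operator words and Young polynomials\<close>

definition operator_word :: "nat \<Rightarrow> (nat \<Rightarrow> nat) \<Rightarrow> nat word"
  where "operator_word n v =
    foldl Prod (Prod (Gen 0) (Gen 1)) (map (\<lambda>i. Gen (v i + 2)) [0..<n])"

text \<open>
  Composition with \<open>\<tau>\<close> on the left permutes the variables within the rows, composition with \<open>\<sigma>\<close> on the right
  permutes the positions within the columns.
\<close>
definition young_poly :: "nat \<Rightarrow> (nat \<Rightarrow> nat) \<Rightarrow> (nat \<Rightarrow> nat) \<Rightarrow> ('k::field, nat) nonassoc_poly"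
  where "young_poly n row col =
    (\<Sum>\<sigma>\<in>fibre_permutations n col. \<Sum>\<tau>\<in>fibre_permutations n row.
      Poly_Mapping.single (operator_word n (\<tau> \<circ> \<sigma>)) (of_int (sign \<sigma>)))"

lemma letters_foldl_Prod: "letters (foldl Prod w (map (\<lambda>i. Gen (f i)) xs)) = letters w @ map f xs"
  by (induction xs rule: rev_induct) auto

lemma letters_operator_word: "letters (operator_word n v) = [0, 1] @ map (\<lambda>i. v i + 2) [0..<n]"
  by (simp add: operator_word_def letters_foldl_Prod)

lemma young_poly_multilinear: "multilinear (young_poly n row col)"
  unfolding multilinear_def
proof (intro exI ballI)
  fix w assume "w \<in> Poly_Mapping.keys (young_poly n row col)"
  then obtain \<sigma> \<tau> where mem: "\<sigma> \<in> fibre_permutations n col" "\<tau> \<in> fibre_permutations n row"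
    and w: "w = operator_word n (\<tau> \<circ> \<sigma>)"
    unfolding young_poly_def
    by (auto dest!: subsetD[OF keys_sum] split: if_splits)
  then have v: "\<tau> \<circ> \<sigma> permutes {..<n}"
    by (auto simp: fibre_permutations_def intro: permutes_compose)
  have "map (\<lambda>i. (\<tau> \<circ> \<sigma>) i + 2) [0..<n] = map (\<lambda>i. i + 2) (map (\<tau> \<circ> \<sigma>) [0..<n])" by simp
  moreover have "set (map (\<tau> \<circ> \<sigma>) [0..<n]) = {..<n}"
    using permutes_image[OF v] by (simp add: atLeast0LessThan)
  moreover have "distinct (map (\<tau> \<circ> \<sigma>) [0..<n])"
    using permutes_inj[OF v] by (auto simp: distinct_map intro: inj_on_subset)
  ultimately show "distinct (letters w) \<and> set (letters w) = {0, 1} \<union> (\<lambda>i. i + 2) ` {..<n}"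
    unfolding w letters_operator_word
    by (auto simp: distinct_map inj_on_def simp del: map_map)
qed

text \<open>
  Sums over the support are linear, whatever cancels between the monomials.
\<close>
lemma sum_over_keys:
  fixes G :: "'x word \<Rightarrow> 'k::field"
  assumes "finite J"
  shows "(\<Sum>w\<in>Poly_Mapping.keys (\<Sum>j\<in>J. Poly_Mapping.single (W j) (c j)).
      Poly_Mapping.lookup (\<Sum>j\<in>J. Poly_Mapping.single (W j) (c j)) w * G w) = (\<Sum>j\<in>J. c j * G (W j))"
  using assms
proof (induction J rule: finite_induct)
  case (insert j J)
  let ?q = "\<Sum>j\<in>J. Poly_Mapping.single (W j) (c j)"
  have "(\<Sum>w\<in>Poly_Mapping.keys (Poly_Mapping.single (W j) (c j) + ?q).
        Poly_Mapping.lookup (Poly_Mapping.single (W j) (c j) + ?q) w * G w) =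
      (\<Sum>w\<in>Poly_Mapping.keys (Poly_Mapping.single (W j) (c j)).
        Poly_Mapping.lookup (Poly_Mapping.single (W j) (c j)) w * G w) +
      (\<Sum>w\<in>Poly_Mapping.keys ?q. Poly_Mapping.lookup ?q w * G w)"
    by (rule setsum_keys_plus_distrib) (simp_all add: algebra_simps)
  also have "(\<Sum>w\<in>Poly_Mapping.keys (Poly_Mapping.single (W j) (c j)).
        Poly_Mapping.lookup (Poly_Mapping.single (W j) (c j)) w * G w) = c j * G (W j)"
    by simp
  finally show ?case using insert by simp
qed simp

lemma eval_word_foldl_Prod:
  "eval_word A a (foldl Prod w (map (\<lambda>i. Gen (f i)) xs)) =
    foldl (monoid.mult A) (eval_word A a w) (map (\<lambda>i. a (f i)) xs)"
  by (induction xs rule: rev_induct) auto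

text \<open>
  A composite word has a single factorization in the absolutely free algebra, so the coefficients of
  iterated right multiples are products of coefficients of the factors.
\<close>
lemma lookup_foldl_free_mult:
  "length qs = length us \<Longrightarrow>
   Poly_Mapping.lookup (foldl (monoid.mult (free_superalgebra r s)) p qs) (foldl Prod w us) =
     Poly_Mapping.lookup p w * (\<Prod>i<length us. Poly_Mapping.lookup (qs ! i) (us ! i))"
proof (induction us arbitrary: qs rule: rev_induct)
  case (snoc u us)
  then obtain q qs' where qs: "qs = qs' @ [q]" "length qs' = length us"
    by (metis append_butlast_last_id length_append_singleton length_butlast length_0_conv
        diff_Suc_1 nat.distinct(1))
  have "(\<Prod>i<length us. Poly_Mapping.lookup (qs ! i) ((us @ [u]) ! i)) =
      (\<Prod>i<length us. Poly_Mapping.lookup (qs' ! i) (us ! i))"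
    by (rule prod.cong) (auto simp: qs nth_append)
  then show ?case using snoc.IH[OF qs(2)] by (simp add: qs nth_append)
qed simp

text \<open>
  A generator is not a product, so a word whose left spine is shorter than \<open>n\<close> has coefficient zero in
  every \<open>n\<close>-fold right multiple.
\<close>
lemma right_comb_cases:
  fixes F :: "('k::field, ('k, nat + nat) nonassoc_poly) superalgebra" and r s :: nat
  defines "F \<equiv> free_superalgebra r s"
  shows "(\<exists>w us. length us = n \<and> W = foldl Prod w us) \<or>
   (\<forall>p qs. length qs = n \<longrightarrow>
     Poly_Mapping.lookup (foldl (monoid.mult F) p qs) W = 0)"
proof (induction n arbitrary: W)
  case (Suc n)
  show ?case
  proof (cases W)
    case (Gen x)
    have "Poly_Mapping.lookup (foldl (monoid.mult F) p qs) W = 0"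
      if "length qs = Suc n" for p qs
      using that by (cases qs rule: rev_cases) (auto simp: Gen F_def)
    then show ?thesis by blast
  next
    case (Prod u v)
    from Suc.IH[of u] show ?thesis
    proof
      assume "\<exists>w us. length us = n \<and> u = foldl Prod w us"
      then obtain w us where "length us = n" "u = foldl Prod w us" by blast
      then have "length (us @ [v]) = Suc n \<and> W = foldl Prod w (us @ [v])" by (simp add: Prod)
      then show ?thesis by blast
    next
      assume *: "\<forall>p qs. length qs = n \<longrightarrow>
        Poly_Mapping.lookup (foldl (monoid.mult F) p qs) u = 0"
      have "Poly_Mapping.lookup (foldl (monoid.mult F) p qs) W = 0"
        if "length qs = Suc n" for p qs
        using that * by (cases qs rule: rev_cases) (auto simp: Prod F_def)
      then show ?thesis by blast
    qed
  qed
qed (auto intro: exI[of _ "[]"])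

lemma lookup_super_eval_young_poly:
  fixes a :: "nat \<Rightarrow> ('k::field, nat + nat) nonassoc_poly"
  assumes a: "\<And>v. a v \<in> free_carrier r s"
  shows "Poly_Mapping.lookup (super_eval (free_superalgebra r s) p a (young_poly n row col)) W =
    (\<Sum>\<sigma>\<in>fibre_permutations n col. \<Sum>\<tau>\<in>fibre_permutations n row. of_int (sign \<sigma>) *
      (koszul_sign p ([0, 1] @ map (\<lambda>i. (\<tau> \<circ> \<sigma>) i + 2) [0..<n]) *
        Poly_Mapping.lookup (foldl (monoid.mult (free_superalgebra r s)) (a 0 \<otimes>\<^bsub>free_superalgebra r s\<^esub> a 1)
          (map (\<lambda>i. a ((\<tau> \<circ> \<sigma>) i + 2)) [0..<n])) W))"
proof -
  let ?F = "free_superalgebra r s :: ('k, ('k, nat + nat) nonassoc_poly) superalgebra"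
  let ?f = "young_poly n row col :: ('k, nat) nonassoc_poly"
  let ?C = "fibre_permutations n col" and ?R = "fibre_permutations n row"
  interpret F: superalgebra ?F by (rule free_superalgebra)
  define G where "G w = koszul_sign p (letters w) * Poly_Mapping.lookup (eval_word ?F a w) W" for w
  define W' where "W' j = operator_word n (snd j \<circ> fst j)" for j :: "(nat \<Rightarrow> nat) \<times> (nat \<Rightarrow> nat)"
  define c :: "(nat \<Rightarrow> nat) \<times> (nat \<Rightarrow> nat) \<Rightarrow> 'k" where "c j = of_int (sign (fst j))" for j
  have f: "?f = (\<Sum>j\<in>?C \<times> ?R. Poly_Mapping.single (W' j) (c j))"
    by (simp add: young_poly_def sum.cartesian_product case_prod_unfold c_def W'_def)
  have closed: "eval_word ?F a w \<in> carrier ?F" for w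
    by (rule eval_word_closed[OF F.nonassoc_algebra_axioms]) (simp add: a)
  have "super_eval ?F p a ?f = (\<Sum>w\<in>Poly_Mapping.keys ?f.
      (koszul_sign p (letters w) * Poly_Mapping.lookup ?f w) \<odot>\<^bsub>?F\<^esub> eval_word ?F a w)"
    unfolding super_eval_def using F.smult_carrier[OF closed] by (intro free_finsum) simp_all
  then have "Poly_Mapping.lookup (super_eval ?F p a ?f) W =
      (\<Sum>w\<in>Poly_Mapping.keys ?f. Poly_Mapping.lookup ?f w * G w)"
    by (simp add: lookup_sum G_def mult_ac)
  also have "\<dots> = (\<Sum>j\<in>?C \<times> ?R. c j * G (W' j))"
    unfolding f by (rule sum_over_keys) simp
  also have "\<dots> = (\<Sum>\<sigma>\<in>?C. \<Sum>\<tau>\<in>?R. of_int (sign \<sigma>) * G (operator_word n (\<tau> \<circ> \<sigma>)))"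
    by (simp add: sum.cartesian_product case_prod_unfold c_def W'_def)
  finally show ?thesis
    unfolding G_def letters_operator_word by (simp add: operator_word_def eval_word_foldl_Prod)
qed

lemma lookup_super_eval_young_poly_comb:
  fixes a :: "nat \<Rightarrow> ('k::field, nat + nat) nonassoc_poly"
  assumes a: "\<And>v. a v \<in> free_carrier r s"
  shows "Poly_Mapping.lookup (super_eval (free_superalgebra r s) p a (young_poly n row col))
      (foldl Prod w (map (\<lambda>i. Gen (g i)) [0..<n])) =
    Poly_Mapping.lookup (a 0 \<otimes>\<^bsub>free_superalgebra r s\<^esub> a 1) w *
    (\<Sum>\<sigma>\<in>fibre_permutations n col. \<Sum>\<tau>\<in>fibre_permutations n row. of_int (sign \<sigma>) *
      young_term p n (\<lambda>k x. Poly_Mapping.lookup (a (k + 2)) (Gen x)) g (\<tau> \<circ> \<sigma>))"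
  unfolding lookup_super_eval_young_poly[of a r s, OF a] young_term_def
  by (simp add: lookup_foldl_free_mult sum_distrib_left mult_ac)

lemma composite_foldl_Prod: "composite w \<Longrightarrow> composite (foldl Prod w us)"
  by (induction us rule: rev_induct) auto

text \<open>
  This is where the metabelian law enters: a composite word can be multiplied by generators only.
\<close>
lemma right_comb_generators:
  "composite w \<Longrightarrow> \<not> metabelian_null (foldl Prod w us) \<Longrightarrow> u \<in> set us \<Longrightarrow> \<exists>x. u = Gen x"
proof (induction us rule: rev_induct)
  case (snoc v us)
  then show ?case using composite_foldl_Prod[of w us] by (cases v) auto
qed simp

lemma metabelian_null_right_comb:
  "metabelian_null (foldl Prod w (map (\<lambda>i. Gen (g i)) xs)) \<longleftrightarrow> metabelian_null w"
  by (induction xs rule: rev_induct) auto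

text \<open>
  Compare coefficients at a word \<open>W\<close> outside the ideal. A coefficient can only be nonzero if \<open>W\<close> has the form
  \<open>(\<dots>((u v) g\<^sub>0) \<dots>) g\<^bsub>n-1\<^esub>\<close>. Then the \<open>g\<^sub>i\<close> are generators, since \<open>W\<close> lies outside the ideal, and the
  coefficient is a multiple of the sum treated in \<open>young_sum_vanishes\<close>.
\<close>
proposition young_poly_identity:
  fixes row col :: "nat \<Rightarrow> nat"
  assumes row: "\<And>i. i < n \<Longrightarrow> row i < P" and col: "\<And>i. i < n \<Longrightarrow> col i < Q"
    and size: "r * Q + s * P < n"
  shows "super_satisfies (free_variety_superalgebra {metabelian_poly} r s)
    (young_poly n row col :: ('k::field_char_0, nat) nonassoc_poly)"
  unfolding free_metabelian_super_satisfies_iff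
proof (intro allI impI)
  let ?F = "free_superalgebra r s :: ('k, ('k, nat + nat) nonassoc_poly) superalgebra"
  let ?f = "young_poly n row col :: ('k, nat) nonassoc_poly"
  interpret F: superalgebra ?F by (rule free_superalgebra)
  fix p :: "nat \<Rightarrow> bit" and a assume "\<forall>v. a v \<in> component ?F (p v)"
  then have comp: "a v \<in> component ?F (p v)" for v by blast
  then have a: "a v \<in> free_carrier r s" for v by (simp add: free_component_iff)
  have null: "metabelian_null W" if "Poly_Mapping.lookup (super_eval ?F p a ?f) W \<noteq> 0" for W
  proof (rule ccontr)
    assume good: "\<not> metabelian_null W"
    consider (comb) w us where "length us = n" "W = foldl Prod w us" |
      (other) "\<And>p qs. length qs = n \<Longrightarrow> Poly_Mapping.lookup (foldl (monoid.mult ?F) p qs) W = 0"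
      using right_comb_cases[of n W r s] by blast
    then have "Poly_Mapping.lookup (super_eval ?F p a ?f) W = 0"
    proof cases
      case other
      then show ?thesis unfolding lookup_super_eval_young_poly[of a r s, OF a] by simp
    next
      case comb
      show ?thesis
      proof (cases w)
        case (Gen x)
        then show ?thesis
          unfolding lookup_super_eval_young_poly[of a r s, OF a] comb
          by (simp add: lookup_foldl_free_mult comb)
      next
        case (Prod u v)
        then have "\<forall>i<n. \<exists>x. us ! i = Gen x"
          using right_comb_generators[of w us] good comb by (metis composite.simps(2) nth_mem)
        then obtain g where g: "\<And>i. i < n \<Longrightarrow> us ! i = Gen (g i)" by metis
        then have us: "us = map (\<lambda>i. Gen (g i)) [0..<n]"
          using comb by (intro nth_equalityI) auto
        let ?m = "\<lambda>k x. Poly_Mapping.lookup (a (k + 2)) (Gen x)"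
        let ?par = "case_sum (\<lambda>_. 0) (\<lambda>_. 1) :: nat + nat \<Rightarrow> bit"
        have "(\<Sum>\<sigma>\<in>fibre_permutations n col. \<Sum>\<tau>\<in>fibre_permutations n row.
            of_int (sign \<sigma>) * young_term p n ?m g (\<tau> \<circ> \<sigma>)) = 0"
        proof (cases "g ` {..<n} \<subseteq> Inl ` {..<r} \<union> Inr ` {..<s}")
          case True
          have "p (k + 2) = ?par x" if "?m k x \<noteq> 0" for k x
          proof -
            have "parity (Gen x) = p (k + 2)"
              using comp[of "k + 2"] that by (auto simp: free_component_iff in_keys_iff simp del: parity.simps)
            then show ?thesis by (simp split: sum.splits)
          qed
          then show ?thesis
            by (intro young_sum_vanishes[where m = ?m and p = p and par = ?par, OF row col size _ _ _ True]) auto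
        next
          case False
          then obtain i where i: "i < n" "g i \<notin> Inl ` {..<r} \<union> Inr ` {..<s}" by blast
          have "?m k (g i) = 0" for k
            using a[of "k + 2"] i(2) unfolding free_carrier_iff by fastforce
          then have "young_term p n ?m g v = 0" for v
            using i(1) by (auto simp: young_term_def prod_zero_iff)
          then show ?thesis by simp
        qed
        then show ?thesis
          unfolding comb us lookup_super_eval_young_poly_comb[of a r s, OF a] by simp
      qed
    qed
    with that show False by contradiction
  qed
  have "super_eval ?F p a ?f \<in> carrier ?F"
    by (rule super_eval_closed[OF F.nonassoc_algebra_axioms]) (simp add: a)
  then show "super_eval ?F p a ?f \<in> metabelian_ideal r s"
    using null by (simp add: metabelian_ideal_def in_keys_iff)
qed

text \<open>
  The two kinds of witnesses at once: \<open>line\<close> is the row or the column of a cell, and a cell takes the value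
  \<open>e (line i)\<close>. The coefficient considered is that of the word with the cells in their original places.
\<close>
lemma young_poly_non_identity:
  fixes x :: "nat + nat" and e :: "nat \<Rightarrow> nat + nat"
  assumes par: "\<And>y. y \<in> insert x (range e) \<Longrightarrow> parity (Gen y) = b"
    and gens: "x \<in> Inl ` {..<r} \<union> Inr ` {..<s}"
      "\<And>i. i < n \<Longrightarrow> e (line i) \<in> Inl ` {..<r} \<union> Inr ` {..<s}"
    and nonzero: "\<And>m :: nat \<Rightarrow> nat + nat \<Rightarrow> 'k.
      (\<And>k y. k < n \<Longrightarrow> m k y = (if y = e (line k) then 1 else 0)) \<Longrightarrow>
      (\<Sum>\<sigma>\<in>fibre_permutations n col. \<Sum>\<tau>\<in>fibre_permutations n row.
        of_int (sign \<sigma>) * young_term (\<lambda>_. b) n m (e \<circ> line) (\<tau> \<circ> \<sigma>)) \<noteq> 0"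
  shows "\<not> super_satisfies (free_variety_superalgebra {metabelian_poly} r s)
    (young_poly n row col :: ('k::field, nat) nonassoc_poly)"
proof
  let ?F = "free_superalgebra r s :: ('k, ('k, nat + nat) nonassoc_poly) superalgebra"
  let ?f = "young_poly n row col :: ('k, nat) nonassoc_poly"
  \<comment> \<open>The variables \<open>0\<close> and \<open>1\<close>, and those that do not occur, take the value \<open>x\<close>.\<close>
  define a :: "nat \<Rightarrow> ('k, nat + nat) nonassoc_poly" where
    "a v = Poly_Mapping.single (Gen (if 2 \<le> v \<and> v < n + 2 then e (line (v - 2)) else x)) 1" for v
  have comp: "a v \<in> component ?F b" for v
  proof -
    obtain y where y: "a v = Poly_Mapping.single (Gen y) 1" "y \<in> Inl ` {..<r} \<union> Inr ` {..<s}"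
      "y \<in> insert x (range e)"
    proof (cases "2 \<le> v \<and> v < n + 2")
      case True
      then have "v - 2 < n" by linarith
      then show ?thesis using True gens(2) that[of "e (line (v - 2))"] by (simp add: a_def)
    next
      case False
      then have "a v = Poly_Mapping.single (Gen x) 1" by (simp only: a_def if_False)
      then show ?thesis using gens(1) that[of x] by blast
    qed
    have "parity (Gen y) = b" using par y(3) by blast
    then show ?thesis using y by (simp add: free_component_iff free_carrier_def del: parity.simps)
  qed
  then have carrier: "a v \<in> free_carrier r s" for v by (simp add: free_component_iff)
  assume "super_satisfies (free_variety_superalgebra {metabelian_poly} r s) ?f"
  then have "super_eval ?F (\<lambda>_. b) a ?f \<in> metabelian_ideal r s"
    unfolding free_metabelian_super_satisfies_iff using comp by simp
  moreover have "\<not> metabelian_null (foldl Prod (Prod (Gen x) (Gen x)) (map (\<lambda>i. Gen ((e \<circ> line) i)) [0..<n]))"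
    unfolding metabelian_null_right_comb by simp
  ultimately have "Poly_Mapping.lookup (super_eval ?F (\<lambda>_. b) a ?f)
      (foldl Prod (Prod (Gen x) (Gen x)) (map (\<lambda>i. Gen ((e \<circ> line) i)) [0..<n])) = 0"
    by (auto simp: metabelian_ideal_def in_keys_iff)
  moreover have "Poly_Mapping.lookup (a 0 \<otimes>\<^bsub>?F\<^esub> a 1) (Prod (Gen x) (Gen x)) = 1"
    by (simp add: a_def)
  moreover have "(\<Sum>\<sigma>\<in>fibre_permutations n col. \<Sum>\<tau>\<in>fibre_permutations n row. of_int (sign \<sigma>) *
      young_term (\<lambda>_. b) n (\<lambda>k y. Poly_Mapping.lookup (a (k + 2)) (Gen y)) (e \<circ> line) (\<tau> \<circ> \<sigma>)) \<noteq> 0"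
    by (rule nonzero) (auto simp: a_def lookup_single when_def)
  ultimately show False
    unfolding lookup_super_eval_young_poly_comb[of a r s, OF carrier] by (simp only: mult_1_left)
qed

lemma grid_coordinates:
  fixes P Q :: nat
  shows "i < P * Q \<Longrightarrow> i div Q < P" "i < P * Q \<Longrightarrow> i mod Q < Q"
    "inj_on (\<lambda>i. (i div Q, i mod Q)) {..<P * Q}"
proof -
  show "i < P * Q \<Longrightarrow> i div Q < P" by (simp add: less_mult_imp_div_less)
  show "i < P * Q \<Longrightarrow> i mod Q < Q" by (cases "Q = 0") auto
  show "inj_on (\<lambda>i. (i div Q, i mod Q)) {..<P * Q}"
    by (rule inj_onI) (metis Pair_inject div_mult_mod_eq)
qed

lemma rank_le_of_supervariety_subset:
  fixes \<iota> :: "('k::field_char_0, nat + nat) nonassoc_poly \<Rightarrow> 'u"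
  assumes inj: "inj \<iota>"
    and sub: "(metabelian_supervariety r' s' :: ('k, 'u) superalgebra set) \<subseteq> metabelian_supervariety r s"
  shows "r' \<le> r \<and> s' \<le> s"
proof (rule ccontr)
  have identity: "super_satisfies (free_variety_superalgebra {metabelian_poly} r' s')
      (young_poly (P * Q) (\<lambda>i. i div Q) (\<lambda>i. i mod Q) :: ('k, nat) nonassoc_poly)"
    if "(r', s') \<noteq> (0, 0)" "r * Q + s * P < P * Q" for P Q
    by (rule super_satisfies_of_supervariety_subset[OF inj that(1) sub young_poly_multilinear
          young_poly_identity[where P = P and Q = Q]]) (use that(2) grid_coordinates in auto)
  assume "\<not> (r' \<le> r \<and> s' \<le> s)"
  then consider (even) "r < r'" | (odd) "s < s'" by linarith
  then show False
  proof cases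
    case even
    define P Q where "P = r + 1" and "Q = s * P + 1"
    have "\<not> super_satisfies (free_variety_superalgebra {metabelian_poly} r' s')
        (young_poly (P * Q) (\<lambda>i. i div Q) (\<lambda>i. i mod Q) :: ('k, nat) nonassoc_poly)"
    proof (rule young_poly_non_identity[where e = Inl and x = "Inl 0" and b = 0 and line = "\<lambda>i. i div Q"])
      fix i assume "i < P * Q"
      then have "i div Q < P" by (rule grid_coordinates(1))
      then have "i div Q < r'" using even unfolding P_def by linarith
      then show "(Inl (i div Q) :: nat + nat) \<in> Inl ` {..<r'} \<union> Inr ` {..<s'}" by simp
    next
      fix m :: "nat \<Rightarrow> nat + nat \<Rightarrow> 'k"
      assume "\<And>k y. k < P * Q \<Longrightarrow> m k y = (if y = Inl (k div Q) then 1 else 0)"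
      then show "(\<Sum>\<sigma>\<in>fibre_permutations (P * Q) (\<lambda>i. i mod Q). \<Sum>\<tau>\<in>fibre_permutations (P * Q) (\<lambda>i. i div Q).
          of_int (sign \<sigma>) * young_term (\<lambda>_. 0) (P * Q) m (Inl \<circ> (\<lambda>i. i div Q)) (\<tau> \<circ> \<sigma>)) \<noteq> 0"
        by (intro young_sum_rows[OF grid_coordinates(3)]) auto
    qed (use even in auto)
    moreover have "r * Q + s * P < P * Q" by (simp add: P_def Q_def)
    ultimately show False using identity[of Q P] even by simp
  next
    case odd
    define Q P where "Q = s + 1" and "P = r * Q + 1"
    have "\<not> super_satisfies (free_variety_superalgebra {metabelian_poly} r' s')
        (young_poly (P * Q) (\<lambda>i. i div Q) (\<lambda>i. i mod Q) :: ('k, nat) nonassoc_poly)"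
    proof (rule young_poly_non_identity[where e = Inr and x = "Inr 0" and b = 1 and line = "\<lambda>i. i mod Q"])
      fix i assume "i < P * Q"
      then have "i mod Q < Q" by (rule grid_coordinates(2))
      then have "i mod Q < s'" using odd unfolding Q_def by linarith
      then show "(Inr (i mod Q) :: nat + nat) \<in> Inl ` {..<r'} \<union> Inr ` {..<s'}" by simp
    next
      fix m :: "nat \<Rightarrow> nat + nat \<Rightarrow> 'k"
      assume "\<And>k y. k < P * Q \<Longrightarrow> m k y = (if y = Inr (k mod Q) then 1 else 0)"
      then show "(\<Sum>\<sigma>\<in>fibre_permutations (P * Q) (\<lambda>i. i mod Q). \<Sum>\<tau>\<in>fibre_permutations (P * Q) (\<lambda>i. i div Q).
          of_int (sign \<sigma>) * young_term (\<lambda>_. 1) (P * Q) m (Inr \<circ> (\<lambda>i. i mod Q)) (\<tau> \<circ> \<sigma>)) \<noteq> 0"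
        by (intro young_sum_columns[OF grid_coordinates(3)]) auto
    qed (use odd in auto)
    moreover have "r * Q + s * P < P * Q" by (simp add: P_def Q_def)
    ultimately show False using identity[of Q P] odd by simp
  qed
qed

theorem theorem5:
  fixes r s r' s' :: nat
    and \<iota> :: "('k::field_char_0, nat + nat) nonassoc_poly \<Rightarrow> 'u"
  assumes universe_large: "inj \<iota>"
  shows "((metabelian_supervariety r' s' :: ('k, 'u) superalgebra set)
            \<subseteq> metabelian_supervariety r s \<longrightarrow> r' \<le> r \<and> s' \<le> s) \<and>
         ((metabelian_supervariety r' s' :: ('k, 'u) superalgebra set)
            = metabelian_supervariety r s \<longrightarrow> r' = r \<and> s' = s)"
  using rank_le_of_supervariety_subset[OF universe_large] by (metis le_antisym order_refl)

end
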